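(* There is an absolute constant $\eta_0\in(0,1)$ such that for every $\beta>\tfrac12$ and every $0<\eta\le\eta_0$ the Gram matrix $G_{\beta,\eta}$ with entries $$\frac{K_\eta(x,y)}{\sqrt{K_\eta(x,x)K_\eta(y,y)}},\qquad x,y\in\Lambda^\ast(\beta),$$ fails to be bounded on $\ell^2$, the Hilbert space of square-summable real sequences indexed by the terms of $\Lambda^\ast(\beta)$. Consequently, for such $\beta$ and $\eta$, it is not true that the operator $g\mapsto\big(g(x)/\sqrt{K_\eta(x,x)}\big)_{x\in\Lambda^\ast(\beta)}$ maps $\mathcal H_\eta$ into and onto $\ell^2$.
   Context: Hermite functions: $\psi_m(x)=\frac{2^{1/4}}{\sqrt{2^m m!}}H_m(\sqrt{2\pi}\,x)e^{-\pi x^2}$, $m\ge0$, where $H_m$ is the physicists' Hermite polynomial; $(\psi_m)_{m\ge0}$ is an orthonormal basis of $L^2(\mathbb R)$. For $\eta>0$ and $j\ge0$ let $$a_j=\int_0^{e^{-2}}\frac{e^{-(j+1)t}}{\sqrt t\,[\log(1/t)]^{1+\eta}}\,dt .$$ $\mathcal H_\eta$ is the real Hilbert space of all $g=\sum_{j\ge0}c_j\psi_{4j}$ with $c_j\in\mathbb R$ and $\|g\|_\eta^2:=\sum_{j\ge0}|c_j|^2/a_j<\infty$. Its elements are taken to be continuous functions (each has a continuous representative, and point evaluations are continuous on $\mathcal H_\eta$), and $K_\eta(x,y)=\sum_{j\ge0}a_j\psi_{4j}(x)\psi_{4j}(y)$ is its reproducing kernel. The nodes are $\lambda_n(\beta)=\sqrt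 n/[\log(e+n)]^\beta$, $n\ge0$, and $\Lambda^\ast(\beta)$ is the sequence consisting of the points $\tfrac12,\lambda_0(\beta),\lambda_1(\beta),\lambda_2(\beta),\dots$ (matrices and sequences are indexed by the terms of this sequence). *)

theory Defs
  imports "HOL-Analysis.Analysis" "HOL-Computational_Algebra.Polynomial"
begin

text \<open>Physicists' Hermite polynomials. The recursion is the one obtained by differentiating
  Rodrigues' formula \<open>H\<^sub>n(x) = (-1)^n exp(x^2) (d/dx)^n exp(-x^2)\<close>, that is
  \<open>H\<^sub>n\<^sub>+\<^sub>1 = 2 x H\<^sub>n - H\<^sub>n'\<close>.\<close>

fun hermite_poly :: "nat \<Rightarrow> real poly" where
  "hermite_poly 0 = 1"
| "hermite_poly (Suc m) = [:0, 2:] * hermite_poly m - pderiv (hermite_poly m)"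

definition hermite_fun :: "nat \<Rightarrow> real \<Rightarrow> real" where
  "hermite_fun m x =
     2 powr (1/4) / sqrt (2 ^ m * fact m) * poly (hermite_poly m) (sqrt (2 * pi) * x)
       * exp (- pi * x\<^sup>2)"

definition weight :: "real \<Rightarrow> nat \<Rightarrow> real" where
  "weight \<eta> j =
     (LBINT t:{0<..<exp (- 2)}. exp (- (real j + 1) * t) / (sqrt t * ln (1 / t) powr (1 + \<eta>)))"

text \<open>The underlying set of the Hilbert space \<open>\<H>\<^sub>\<eta>\<close>: the series \<open>\<Sum>j. c j \<psi>\<^sub>4\<^sub>j\<close> is summed in
  \<open>L\<^sup>2(\<real>)\<close>, and \<open>g\<close> is the continuous representative of its sum.\<close>

definition hermite_space :: "real \<Rightarrow> (real \<Rightarrow> real) set" where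
  "hermite_space \<eta> =
     {g. continuous_on UNIV g \<and>
         (\<exists>c :: nat \<Rightarrow> real. summable (\<lambda>j. (c j)\<^sup>2 / weight \<eta> j) \<and>
            (\<lambda>N. \<integral>\<^sup>+ x. ennreal ((g x - (\<Sum>j<N. c j * hermite_fun (4 * j) x))\<^sup>2) \<partial>lborel)
              \<longlonglongrightarrow> 0)}"

definition kernel :: "real \<Rightarrow> real \<Rightarrow> real \<Rightarrow> real" where
  "kernel \<eta> x y = (\<Sum>j. weight \<eta> j * hermite_fun (4 * j) x * hermite_fun (4 * j) y)"

definition node :: "real \<Rightarrow> nat \<Rightarrow> real" where
  "node \<beta> n = sqrt (real n) / ln (exp 1 + real n) powr \<beta>"

text \<open>The sequence \<open>1/2, \<lambda>\<^sub>0, \<lambda>\<^sub>1, \<dots>\<close>; matrices and sequences are indexed by the position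
  of a term, so coinciding values count as different indices.\<close>

definition node_star :: "real \<Rightarrow> nat \<Rightarrow> real" where
  "node_star \<beta> k = (case k of 0 \<Rightarrow> 1/2 | Suc n \<Rightarrow> node \<beta> n)"

definition gram :: "real \<Rightarrow> real \<Rightarrow> nat \<Rightarrow> nat \<Rightarrow> real" where
  "gram \<beta> \<eta> m n =
     kernel \<eta> (node_star \<beta> m) (node_star \<beta> n) /
       sqrt (kernel \<eta> (node_star \<beta> m) (node_star \<beta> m) * kernel \<eta> (node_star \<beta> n) (node_star \<beta> n))"

definition ell2 :: "(nat \<Rightarrow> real) set" where
  "ell2 = {v. summable (\<lambda>n. (v n)\<^sup>2)}"

definition ell2_norm :: "(nat \<Rightarrow> real) \<Rightarrow> real" where
  "ell2_norm v = sqrt (\<Sum>n. (v n)\<^sup>2)"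

definition mat_apply :: "(nat \<Rightarrow> nat \<Rightarrow> real) \<Rightarrow> (nat \<Rightarrow> real) \<Rightarrow> nat \<Rightarrow> real" where
  "mat_apply A v m = (\<Sum>n. A m n * v n)"

text \<open>Convergence of the row sums is required explicitly, since \<open>suminf\<close> is total.\<close>

definition bounded_on_ell2 :: "(nat \<Rightarrow> nat \<Rightarrow> real) \<Rightarrow> bool" where
  "bounded_on_ell2 A \<longleftrightarrow>
     (\<exists>C. \<forall>v\<in>ell2. (\<forall>m. summable (\<lambda>n. A m n * v n)) \<and> mat_apply A v \<in> ell2 \<and>
        ell2_norm (mat_apply A v) \<le> C * ell2_norm v)"

definition sampling :: "real \<Rightarrow> real \<Rightarrow> (real \<Rightarrow> real) \<Rightarrow> nat \<Rightarrow> real" where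
  "sampling \<beta> \<eta> g n = g (node_star \<beta> n) / sqrt (kernel \<eta> (node_star \<beta> n) (node_star \<beta> n))"

end

theory Submission
  imports Defs "HOL-Probability.Distributions" "HOL-Real_Asymp.Real_Asymp"
begin

text \<open>
  The weights \<open>a\<^sub>j\<close> are moments of a measure in a time variable \<open>t\<close>, so the kernel is a superposition
  \<open>K(x,y) = \<integral> e\<^sup>-\<^sup>t k\<^sub>t(x,y) / (\<surd>t log(1/t)\<^bsup>1+\<eta>\<^esup>) dt\<close> of the kernels
  \<open>k\<^sub>t(x,y) = \<Sum>\<^sub>j e\<^bsup>-jt\<^esup> \<psi>\<^sub>4\<^sub>j(x) \<psi>\<^sub>4\<^sub>j(y)\<close>. Mehler's formula, averaged over the four rotations \<open>\<i>\<^sup>k\<close> of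
  its parameter, expresses \<open>k\<^sub>t\<close> as two positive Gaussians in \<open>x - y\<close> and \<open>x + y\<close>, of height about \<open>1 / \<surd>t\<close>
  and damped by \<open>exp(- c t (x\<^sup>2 + y\<^sup>2))\<close>, plus an error of size at most \<open>exp(- c t (x\<^sup>2 + y\<^sup>2))\<close>.
  The main part thus integrates against the density \<open>1 / (t log(1/t)\<^bsup>1+\<eta>\<^esup>)\<close>, which has the
  primitive \<open>log(1/t)\<^bsup>-\<eta>\<^esup> / \<eta>\<close>.

  Near a large \<open>R\<close> only \<open>t \<lesssim> 1/R\<^sup>2\<close> matters on the diagonal, which gives
  \<open>K(x,x) \<le> C (log R)\<^bsup>-\<eta>\<^esup>\<close> (\<open>kernel_decay\<close>). If \<open>x\<close> and \<open>y\<close> are both within \<open>1/R\<close> of \<open>R\<close>, the times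
  \<open>t \<in> [1/R\<^sup>2, 2/R\<^sup>2]\<close> alone contribute \<open>c (log R)\<^bsup>-1-\<eta>\<^esup>\<close>, and the error contributes only
  \<open>O(1/R)\<close> (\<open>kernel_lower_near\<close>). Hence every normalized entry for two such points is at least
  \<open>c / log R\<close> (\<open>normalized_kernel_near\<close>); the powers \<open>(log R)\<^bsup>-\<eta>\<^esup>\<close>
  cancel.

  The nodes crowd: about \<open>(log M)\<^bsup>2\<beta>\<^esup>\<close> consecutive nodes after \<open>R = \<lambda>\<^sub>M\<close> lie within \<open>1/R\<close> of
  \<open>R\<close> (\<open>node_cluster\<close>). The Gram matrix therefore contains square blocks of size \<open>N\<close> with all
  entries at least \<open>a\<close>, where \<open>a N\<close> is of order \<open>(log M)\<^bsup>2\<beta>-1\<^esup>\<close>, and this is unbounded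
  exactly because \<open>\<beta> > 1/2\<close> (\<open>gram_clusters\<close>). Testing on the indicator of a block shows that
  the Gram matrix is unbounded.

  For the sampling operator, identify \<open>\<H>\<^sub>\<eta>\<close> with \<open>\<ell>\<^sup>2\<close> through the orthonormal basis
  \<open>\<surd>a\<^sub>j \<psi>\<^sub>4\<^sub>j\<close> (\<open>synthesis_in_hermite_space\<close>). If all sample sequences were in \<open>\<ell>\<^sup>2\<close>, the uniform boundedness
  principle would bound the operator, and the sum of the normalized kernels over a block
  contradicts this bound. So the image is not even contained in \<open>\<ell>\<^sup>2\<close>.
\<close>

section \<open>Hermite polynomials\<close>

lemma pderiv_hermite_poly:
  "pderiv (hermite_poly m) = smult (2 * real m) (hermite_poly (m - 1))"
proof (induction m rule: less_induct)
  case (less m)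
  show ?case
  proof (cases m)
    case (Suc k)
    show ?thesis
    proof (cases k)
      case (Suc l)
      have a: "pderiv (hermite_poly k) = smult (2 * real k) (hermite_poly l)"
        using less[of k] \<open>m = Suc k\<close> Suc by simp
      have b: "pderiv (hermite_poly l) = smult (2 * real l) (hermite_poly (l - 1))"
        using less[of l] \<open>m = Suc k\<close> Suc by simp
      have c: "hermite_poly k = [:0, 2:] * hermite_poly l - pderiv (hermite_poly l)"
        using Suc by simp
      have "pderiv (hermite_poly m) =
          smult 2 (hermite_poly k) + [:0, 2:] * pderiv (hermite_poly k)
            - pderiv (pderiv (hermite_poly k))"
        using \<open>m = Suc k\<close> by (simp add: pderiv_mult pderiv_diff pderiv_smult pderiv_pCons algebra_simps)
      also have "\<dots> = smult 2 (hermite_poly k) +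
          smult (2 * real k) ([:0, 2:] * hermite_poly l - pderiv (hermite_poly l))"
        unfolding a by (simp add: pderiv_smult smult_diff_right)
      also have "\<dots> = smult (2 * real m) (hermite_poly k)"
        unfolding c[symmetric] using \<open>m = Suc k\<close>
        by (metis distrib_left mult.right_neutral of_nat_Suc smult_add_left add.commute)
      finally show ?thesis using \<open>m = Suc k\<close> by simp
    qed (use \<open>m = Suc k\<close> in \<open>simp add: pderiv_pCons\<close>)
  qed simp
qed

lemma poly_hermite_Suc_Suc:
  "poly (hermite_poly (Suc (Suc m))) x =
     2 * x * poly (hermite_poly (Suc m)) x - 2 * real (Suc m) * poly (hermite_poly m) x"
proof -
  have "hermite_poly (Suc (Suc m)) = [:0, 2:] * hermite_poly (Suc m)
      - smult (2 * real (Suc m)) (hermite_poly m)"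
    using pderiv_hermite_poly[of "Suc m"] hermite_poly.simps(2)[of "Suc m"] by simp
  thus ?thesis by (simp only: poly_diff poly_mult poly_smult poly_pCons poly_0) (simp add: algebra_simps)
qed

text \<open>These are the products of the \<open>m\<close>-th \<open>L\<^sup>2\<close>-normalized Hermite polynomials at \<open>x\<close> and \<open>y\<close> with
  respect to the weight \<open>exp(-x\<^sup>2)\<close>, up to a factor \<open>\<surd>\<pi>\<close>.\<close>

definition mehler_coeff :: "real \<Rightarrow> real \<Rightarrow> nat \<Rightarrow> real" where
  "mehler_coeff x y m =
     poly (hermite_poly m) x * poly (hermite_poly m) y / (2 ^ m * fact m)"

text \<open>In the three-term recurrence for the normalized polynomials the coefficient of the middle term
  tends to zero and the other one is below 1 in absolute value. So the values grow more slowly than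
  any geometric sequence, and power series in these coefficients converge on the whole unit disc.\<close>

lemma mehler_coeff_growth_diag:
  assumes "\<rho> > 1"
  shows "\<exists>C. \<forall>m. mehler_coeff x x m \<le> C * \<rho> ^ (2 * m)"
proof -
  define a where "a m = \<bar>poly (hermite_poly m) x\<bar> / sqrt (2 ^ m * fact m)" for m
  have a0: "a m \<ge> 0" for m by (simp add: a_def)
  have qa: "mehler_coeff x x m = (a m)\<^sup>2" for m
    by (simp add: mehler_coeff_def a_def power_divide power2_eq_square)
  have step: "a (Suc (Suc m)) \<le> \<bar>x\<bar> * sqrt (2 / (real m + 2)) * a (Suc m) + a m" for m
  proof -
    define P where "P = sqrt (2 ^ m * fact m :: real)"
    define u where "u = sqrt (2 * (real m + 1))"
    define v where "v = sqrt (2 * (real m + 2))"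
    have P: "P > 0" "u > 0" "v > 0" by (simp_all add: P_def u_def v_def)
    have s1: "sqrt (2 ^ Suc m * fact (Suc m) :: real) = u * P"
      unfolding P_def u_def by (simp add: real_sqrt_mult[symmetric] algebra_simps)
    have s2: "sqrt (2 ^ Suc (Suc m) * fact (Suc (Suc m)) :: real) = v * (u * P)"
      unfolding P_def u_def v_def by (simp add: real_sqrt_mult[symmetric] algebra_simps)
    have uv: "u \<le> v" by (simp add: u_def v_def)
    have uu: "u * u = 2 * (real m + 1)" and vv: "v * v = 2 * (real m + 2)"
      by (simp_all add: u_def v_def)
    have sv: "sqrt (2 / (real m + 2)) = 2 / v"
    proof -
      have "sqrt (2 / (real m + 2)) = sqrt (4 / (v * v))" unfolding vv by (simp add: field_simps)
      also have "\<dots> = 2 / v" using P by (simp add: real_sqrt_divide)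
      finally show ?thesis .
    qed
    let ?h = "\<lambda>m. poly (hermite_poly m) x"
    have "\<bar>?h (Suc (Suc m))\<bar> \<le> 2 * \<bar>x\<bar> * \<bar>?h (Suc m)\<bar> + u * u * \<bar>?h m\<bar>"
      unfolding poly_hermite_Suc_Suc uu
      by (rule order_trans[OF abs_triangle_ineq4]) (simp add: abs_mult add.commute del: hermite_poly.simps)
    also have "\<dots> \<le> 2 * \<bar>x\<bar> * \<bar>?h (Suc m)\<bar> + u * v * \<bar>?h m\<bar>"
      using uv P by (intro add_left_mono mult_right_mono mult_left_mono) auto
    finally have "\<bar>?h (Suc (Suc m))\<bar> / (v * (u * P)) \<le>
        (2 * \<bar>x\<bar> * \<bar>?h (Suc m)\<bar> + u * v * \<bar>?h m\<bar>) / (v * (u * P))"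
      using P by (intro divide_right_mono) auto
    also have "\<dots> = \<bar>x\<bar> * (2 / v) * (\<bar>?h (Suc m)\<bar> / (u * P)) + \<bar>?h m\<bar> / P"
      using P by (simp add: field_simps)
    finally show ?thesis unfolding a_def s1 s2 sv P_def[symmetric] .
  qed
  have "(\<lambda>m. \<bar>x\<bar> * sqrt (2 / (real m + 2))) \<longlonglongrightarrow> 0" by real_asymp
  moreover have "\<rho> - 1 / \<rho> > 0" using assms by (simp add: field_simps less_1_mult)
  ultimately have "eventually (\<lambda>m. \<bar>x\<bar> * sqrt (2 / (real m + 2)) < \<rho> - 1 / \<rho>) sequentially"
    by (rule order_tendstoD)
  then obtain m0 where m0: "\<And>m. m \<ge> m0 \<Longrightarrow> \<bar>x\<bar> * sqrt (2 / (real m + 2)) < \<rho> - 1 / \<rho>"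
    by (auto simp: eventually_sequentially)
  define C where "C = (\<Sum>k\<le>Suc m0. a k)"
  have base: "a m \<le> C" if "m \<le> Suc m0" for m
    unfolding C_def using that a0 by (intro member_le_sum) auto
  have C0: "C \<ge> 0" unfolding C_def by (intro sum_nonneg) (auto simp: a0)
  have bound: "a m \<le> C * \<rho> ^ m" for m
  proof (induction m rule: less_induct)
    case (less m)
    show ?case
    proof (cases "m \<le> Suc m0")
      case True
      have "C * 1 \<le> C * \<rho> ^ m" using C0 assms by (intro mult_left_mono one_le_power) auto
      thus ?thesis using base[OF True] by simp
    next
      case False
      then obtain k where k: "m = Suc (Suc k)" "k \<ge> m0"
        by (metis Suc_le_D not_less_eq_eq Suc_le_mono nle_le)
      have "a m \<le> \<bar>x\<bar> * sqrt (2 / (real k + 2)) * a (Suc k) + a k" using step k by simp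
      also have "\<dots> \<le> (\<rho> - 1 / \<rho>) * (C * \<rho> ^ Suc k) + C * \<rho> ^ k"
        using less[of k] less[of "Suc k"] k m0[of k] a0[of "Suc k"] \<open>\<rho> - 1 / \<rho> > 0\<close>
        by (intro add_mono mult_mono) auto
      also have "\<dots> = C * \<rho> ^ m" using k assms by (simp add: field_simps)
      finally show ?thesis .
    qed
  qed
  show ?thesis
  proof (intro exI allI)
    fix m
    have "(a m)\<^sup>2 \<le> (C * \<rho> ^ m)\<^sup>2" using bound a0 by (intro power_mono) auto
    thus "mehler_coeff x x m \<le> C\<^sup>2 * \<rho> ^ (2 * m)"
      by (simp add: qa power_mult_distrib power_mult[symmetric] mult.commute)
  qed
qed

lemma mehler_coeff_diag_nonneg: "mehler_coeff x x m \<ge> 0"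
  by (simp add: mehler_coeff_def)

lemma abs_mehler_coeff_le:
  "\<bar>mehler_coeff x y m\<bar> \<le> (mehler_coeff x x m + mehler_coeff y y m) / 2"
proof -
  have *: "\<bar>u * v\<bar> \<le> (u * u + v * v) / 2" for u v :: real
    using sum_squares_bound[of "\<bar>u\<bar>" "\<bar>v\<bar>"] by (simp add: abs_mult power2_eq_square)
  have "\<bar>mehler_coeff x y m\<bar> =
      \<bar>poly (hermite_poly m) x * poly (hermite_poly m) y\<bar> / (2 ^ m * fact m)"
    by (simp add: mehler_coeff_def)
  also have "\<dots> \<le> ((poly (hermite_poly m) x * poly (hermite_poly m) x +
      poly (hermite_poly m) y * poly (hermite_poly m) y) / 2) / (2 ^ m * fact m)"
    by (intro divide_right_mono *) auto
  also have "\<dots> = (mehler_coeff x x m + mehler_coeff y y m) / 2"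
    by (simp add: mehler_coeff_def field_simps)
  finally show ?thesis .
qed

lemma summable_mehler:
  fixes r :: real
  assumes "0 \<le> r" "r < 1"
  shows "summable (\<lambda>m. \<bar>mehler_coeff x y m\<bar> * r ^ m)"
proof -
  have diag: "summable (\<lambda>m. mehler_coeff x x m * r ^ m)" for x
  proof -
    obtain \<rho> where \<rho>: "\<rho> > 1" "\<rho>\<^sup>2 * r < 1"
    proof (cases "r = 0")
      case True thus ?thesis using that[of 2] by simp
    next
      case False
      define \<rho> where "\<rho> = sqrt ((1 + 1 / r) / 2)"
      have "\<rho> > 1" using False assms by (simp add: \<rho>_def field_simps)
      moreover have "\<rho>\<^sup>2 * r < 1" using False assms by (simp add: \<rho>_def field_simps)
      ultimately show ?thesis using that by blast
    qed
    obtain C where C: "\<And>m. mehler_coeff x x m \<le> C * \<rho> ^ (2 * m)"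
      using mehler_coeff_growth_diag[OF \<rho>(1)] by blast
    show ?thesis
    proof (rule summable_comparison_test')
      show "summable (\<lambda>m. C * (\<rho>\<^sup>2 * r) ^ m)"
        using \<rho> assms by (intro summable_mult summable_geometric) (simp add: abs_mult)
      fix m
      show "norm (mehler_coeff x x m * r ^ m) \<le> C * (\<rho>\<^sup>2 * r) ^ m"
        using mult_right_mono[OF C, of "r ^ m" m] assms mehler_coeff_diag_nonneg[of x m]
        by (simp add: abs_mult power_mult_distrib mult_ac flip: power_mult)
    qed
  qed
  show ?thesis
  proof (rule summable_comparison_test')
    show "summable (\<lambda>m. (mehler_coeff x x m * r ^ m + mehler_coeff y y m * r ^ m) / 2)"
      by (intro summable_divide summable_add diag)
    fix m
    show "norm (\<bar>mehler_coeff x y m\<bar> * r ^ m) \<le>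
        (mehler_coeff x x m * r ^ m + mehler_coeff y y m * r ^ m) / 2"
      using mult_right_mono[OF abs_mehler_coeff_le, of "r ^ m" x y m] assms
      by (simp add: abs_mult distrib_right add_divide_distrib)
  qed
qed

section \<open>Mehler's formula\<close>

text \<open>Products of two solutions of second-order recurrences span a four-dimensional space, so five
  consecutive products satisfy a linear relation. This is that relation with the denominators cleared.\<close>

lemma product_recurrence_identity: 
  fixes x y n :: real
  assumes X2: "X2 = 2 * x * X1 - 2 * (n + 1) * X0" and Y2: "Y2 = 2 * y * Y1 - 2 * (n + 1) * Y0"
  and X3: "X3 = 2 * x * X2 - 2 * (n + 2) * X1" and Y3: "Y3 = 2 * y * Y2 - 2 * (n + 2) * Y1"
  and X4: "X4 = 2 * x * X3 - 2 * (n + 3) * X2" and Y4: "Y4 = 2 * y * Y3 - 2 * (n + 3) * Y2"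
  shows "X4 * Y4  - 8 * ((n + 2) * ((n + 3) * (X2 * Y2)))
      + 2*n * (8 * (n + 1) * (n + 2) * (n + 3) * (X0 * Y0))
    = 4 * (n + 3) * (X2 * Y2) - 16 * (n + 1) * (n + 2) * (n + 3) * (X0 * Y0)
      + 4 * x * y * (X3 * Y3) + 4 * x * y * (4 * (n + 2) * (n + 3) * (X1 * Y1)) - 4 * (x^2+y^2) * (2 * (n + 3) * (X2 * Y2))"
  using assms by algebra

lemma mehler_coeff_recurrence:
  fixes x y :: real and k :: nat
  defines "q \<equiv> mehler_coeff x y" and "c \<equiv> 2 * x * y" and "d \<equiv> 2 * (x\<^sup>2 + y\<^sup>2)"
  shows "real (k + 4) * q (k + 4) - 2 * (real (k + 2) * q (k + 2)) + real k * q k =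
     q (k + 2) - q k + c * q (k + 3) + c * q (k + 1) - d * q (k + 2)"
proof -
  define n where "n = real k"
  define D where "D = (2 ^ k * fact k :: real)"
  define X where "X j = poly (hermite_poly (k + j)) x" for j
  define Y where "Y j = poly (hermite_poly (k + j)) y" for j
  have D: "D > 0" by (simp add: D_def)
  have n: "n \<ge> 0" by (simp add: n_def)
  have X2: "X 2 = 2 * x * X 1 - 2 * (n + 1) * X 0" and Y2: "Y 2 = 2 * y * Y 1 - 2 * (n + 1) * Y 0"
    using poly_hermite_Suc_Suc[of k x] poly_hermite_Suc_Suc[of k y]
    by (simp_all add: X_def Y_def n_def numeral_2_eq_2 add.commute del: hermite_poly.simps)
  have X3: "X 3 = 2 * x * X 2 - 2 * (n + 2) * X 1" and Y3: "Y 3 = 2 * y * Y 2 - 2 * (n + 2) * Y 1"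
    using poly_hermite_Suc_Suc[of "k + 1" x] poly_hermite_Suc_Suc[of "k + 1" y]
    by (simp_all add: X_def Y_def n_def numeral_3_eq_3 numeral_2_eq_2 add.commute del: hermite_poly.simps)
  have X4: "X 4 = 2 * x * X 3 - 2 * (n + 3) * X 2" and Y4: "Y 4 = 2 * y * Y 3 - 2 * (n + 3) * Y 2"
    using poly_hermite_Suc_Suc[of "k + 2" x] poly_hermite_Suc_Suc[of "k + 2" y]
    by (simp_all add: X_def Y_def n_def eval_nat_numeral add.commute del: hermite_poly.simps)
  have q: "q k = X 0 * Y 0 / D" "q (k + 1) = X 1 * Y 1 / (2 * (n + 1) * D)"
    "q (k + 2) = X 2 * Y 2 / (4 * (n + 1) * (n + 2) * D)"
    "q (k + 3) = X 3 * Y 3 / (8 * (n + 1) * (n + 2) * (n + 3) * D)"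
    "q (k + 4) = X 4 * Y 4 / (16 * (n + 1) * (n + 2) * (n + 3) * (n + 4) * D)"
    by (simp_all add: q_def mehler_coeff_def X_def Y_def D_def n_def eval_nat_numeral algebra_simps
        del: hermite_poly.simps)
  define W where "W = 8 * (n + 1) * (n + 2) * (n + 3) * D"
  have W: "W \<noteq> 0" using n D by (auto simp: W_def)
  have nz: "n + 1 \<noteq> 0" "n + 2 \<noteq> 0" "n + 3 \<noteq> 0" "n + 4 \<noteq> 0" "D \<noteq> 0" using n D by auto
  have w: "q k = 8 * (n + 1) * (n + 2) * (n + 3) * (X 0 * Y 0) / W"
    "q (k + 1) = 4 * (n + 2) * (n + 3) * (X 1 * Y 1) / W"
    "q (k + 2) = 2 * (n + 3) * (X 2 * Y 2) / W"
    "q (k + 3) = X 3 * Y 3 / W"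
    "(n + 4) * q (k + 4) = X 4 * Y 4 / 2 / W"
    unfolding q W_def using nz by (simp_all add: divide_simps) (simp_all add: algebra_simps)
  have r: "real k = n" "real (k + 2) = n + 2" "real (k + 4) = n + 4" by (simp_all add: n_def)
  have key: "X 4 * Y 4 / 2 - 2 * ((n + 2) * (2 * (n + 3) * (X 2 * Y 2)))
      + n * (8 * (n + 1) * (n + 2) * (n + 3) * (X 0 * Y 0))
    = 2 * (n + 3) * (X 2 * Y 2) - 8 * (n + 1) * (n + 2) * (n + 3) * (X 0 * Y 0)
      + c * (X 3 * Y 3) + c * (4 * (n + 2) * (n + 3) * (X 1 * Y 1)) - d * (2 * (n + 3) * (X 2 * Y 2))"
    using product_recurrence_identity[OF X2 Y2 X3 Y3 X4 Y4] unfolding c_def d_def by linarith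
  have "real (k + 4) * q (k + 4) - 2 * (real (k + 2) * q (k + 2)) + real k * q k =
     (X 4 * Y 4 / 2 - 2 * ((n + 2) * (2 * (n + 3) * (X 2 * Y 2)))
      + n * (8 * (n + 1) * (n + 2) * (n + 3) * (X 0 * Y 0))) / W"
    unfolding r w by (simp add: add_divide_distrib diff_divide_distrib)
  also have "\<dots> = q (k + 2) - q k + c * q (k + 3) + c * q (k + 1) - d * q (k + 2)"
    unfolding key w by (simp add: add_divide_distrib diff_divide_distrib)
  finally show ?thesis .
qed

lemma mehler_coeff_initial:
  fixes x y :: real
  defines "q \<equiv> mehler_coeff x y" and "c \<equiv> 2 * x * y" and "d \<equiv> 2 * (x\<^sup>2 + y\<^sup>2)"
  shows "q 0 = 1" "q 1 = c * q 0" "2 * q 2 = q 0 + c * q 1 - d * q 0"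
    "3 * q 3 - 2 * q 1 = q 1 + c * q 2 + c * q 0 - d * q 1"
proof -
  have h: "poly (hermite_poly 0) z = 1" "poly (hermite_poly 1) z = 2 * z"
    "poly (hermite_poly 2) z = 4 * z\<^sup>2 - 2" "poly (hermite_poly 3) z = 8 * z ^ 3 - 12 * z" for z
  proof -
    show h0: "poly (hermite_poly 0) z = 1" and h1: "poly (hermite_poly 1) z = 2 * z" by simp_all
    show h2: "poly (hermite_poly 2) z = 4 * z\<^sup>2 - 2"
      using poly_hermite_Suc_Suc[of 0 z] h0 h1 by (simp add: numeral_2_eq_2 power2_eq_square)
    show "poly (hermite_poly 3) z = 8 * z ^ 3 - 12 * z"
      using poly_hermite_Suc_Suc[of 1 z]
      unfolding Suc_1 One_nat_def[symmetric] numeral_3_eq_3[symmetric] h2 h1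
      by (simp add: numeral_3_eq_3[symmetric] algebra_simps power2_eq_square power3_eq_cube del: hermite_poly.simps)
  qed
  have q: "q 0 = 1" "q 1 = 2 * x * y" "q 2 = (2 * x\<^sup>2 - 1) * (2 * y\<^sup>2 - 1) / 2"
    "q 3 = (2 * x ^ 3 - 3 * x) * (2 * y ^ 3 - 3 * y) / 3"
    by (simp_all only: q_def mehler_coeff_def h) (simp_all add: fact_numeral field_simps)
  show "q 0 = 1" "q 1 = c * q 0" "2 * q 2 = q 0 + c * q 1 - d * q 0"
    "3 * q 3 - 2 * q 1 = q 1 + c * q 2 + c * q 0 - d * q 1"
    unfolding q c_def d_def
    by (simp_all add: algebra_simps power2_eq_square power3_eq_cube add_divide_distrib diff_divide_distrib)
qed

definition mehler_fps :: "real \<Rightarrow> real \<Rightarrow> complex fps" where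
  "mehler_fps x y = Abs_fps (\<lambda>m. of_real (mehler_coeff x y m))"

text \<open>The logarithmic derivative of Mehler's closed form is the rational function that this first-order
  equation exhibits; read coefficientwise, the equation is \<open>mehler_coeff_recurrence\<close>.\<close>

lemma mehler_fps_ode:
  fixes x y :: real
  defines "Q \<equiv> mehler_fps x y"
    and "c \<equiv> fps_const (of_real (2 * x * y))" and "d \<equiv> fps_const (of_real (2 * (x\<^sup>2 + y\<^sup>2)))"
  shows "(1 - fps_X ^ 2) ^ 2 * fps_deriv Q =
           (fps_X * (1 - fps_X ^ 2) + c * (1 + fps_X ^ 2) - d * fps_X) * Q"
proof -
  note [simp del] = hermite_poly.simps
  have "fps_deriv Q - 2 * (fps_X ^ 2 * fps_deriv Q) + fps_X ^ 4 * fps_deriv Q =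
      fps_X ^ 1 * Q - fps_X ^ 3 * Q + c * Q + c * (fps_X ^ 2 * Q) - d * (fps_X ^ 1 * Q)"
    (is "?L = ?R")
  proof (rule fps_ext)
    fix n :: nat
    define q where "q = mehler_coeff x y"
    have L: "fps_nth ?L n = of_real (real (n + 1) * q (n + 1)
        - 2 * (if n < 2 then 0 else real (n - 2 + 1) * q (n - 2 + 1))
        + (if n < 4 then 0 else real (n - 4 + 1) * q (n - 4 + 1)))"
      unfolding fps_mult_numeral_left fps_sub_nth fps_add_nth fps_X_power_mult_nth
      by (simp add: Q_def mehler_fps_def q_def)
    have R: "fps_nth ?R n = of_real ((if n < 1 then 0 else q (n - 1)) - (if n < 3 then 0 else q (n - 3))
        + 2 * x * y * q n + 2 * x * y * (if n < 2 then 0 else q (n - 2))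
        - 2 * (x\<^sup>2 + y\<^sup>2) * (if n < 1 then 0 else q (n - 1)))"
      unfolding c_def d_def fps_mult_left_const_nth fps_sub_nth fps_add_nth fps_X_power_mult_nth
      by (simp add: Q_def mehler_fps_def q_def)
    have "n = 0 \<or> n = 1 \<or> n = 2 \<or> n = (n - 3) + 3" by arith
    then consider "n = 0" | "n = 1" | "n = 2" | k where "n = k + 3" by blast
    then show "fps_nth ?L n = fps_nth ?R n"
    proof cases
      case 1
      show ?thesis unfolding L R of_real_eq_iff using 1 mehler_coeff_initial[of x y]
        by (simp add: q_def flip: numeral_2_eq_2)
    next
      case 2
      show ?thesis unfolding L R of_real_eq_iff using 2 mehler_coeff_initial[of x y]
        by (simp add: q_def flip: numeral_2_eq_2)
    next
      case 3
      show ?thesis unfolding L R of_real_eq_iff using 3 mehler_coeff_initial[of x y]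
        by (simp add: q_def flip: numeral_2_eq_2)
    next
      case (4 k)
      have e: "n + 1 = k + 4" "n - 2 + 1 = k + 2" "n - 1 = k + 2" "n - 2 = k + 1" "n - 3 = k"
        "(n < 4) = (k = 0)" "\<not> n < 1" "\<not> n < 2" "\<not> n < 3" "n = k + 3"
        "k \<noteq> 0 \<Longrightarrow> n - 4 + 1 = k"
        using 4 by auto
      have "real (n + 1) * q (n + 1) - 2 * (real (n - 2 + 1) * q (n - 2 + 1))
          + (if n < 4 then 0 else real (n - 4 + 1) * q (n - 4 + 1))
        = q (n - 1) - q (n - 3) + 2 * x * y * q n + 2 * x * y * q (n - 2)
           - 2 * (x\<^sup>2 + y\<^sup>2) * q (n - 1)"
        using mehler_coeff_recurrence[of k x y] e
        by (cases "k = 0") (simp_all add: q_def add.commute flip: numeral_2_eq_2)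
      thus ?thesis unfolding L R using e by simp
    qed
  qed
  thus ?thesis by (simp add: algebra_simps power2_eq_square eval_nat_numeral)
qed

lemma fps_conv_radius_mehler: "fps_conv_radius (mehler_fps x y) \<ge> 1"
  unfolding fps_conv_radius_def
proof (rule conv_radius_geI_ex')
  fix r :: real assume r: "0 < r" "ereal r < 1"
  show "summable (\<lambda>n. fps_nth (mehler_fps x y) n * of_real r ^ n)"
  proof (rule summable_norm_cancel)
    show "summable (\<lambda>n. norm (fps_nth (mehler_fps x y) n * complex_of_real r ^ n))"
      using summable_mehler[of r x y] r
      by (simp add: mehler_fps_def norm_mult norm_power)
  qed
qed

lemma one_minus_square_not_nonpos:
  assumes "cmod r < 1" shows "1 - r\<^sup>2 \<notin> \<real>\<^sub>\<le>\<^sub>0"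
proof
  assume "1 - r\<^sup>2 \<in> \<real>\<^sub>\<le>\<^sub>0"
  hence "Re (1 - r\<^sup>2) \<le> 0" by (simp add: complex_nonpos_Reals_iff)
  moreover have "Re (r\<^sup>2) \<le> cmod (r\<^sup>2)" by (rule complex_Re_le_cmod)
  moreover have "cmod (r\<^sup>2) < 1" using assms by (simp add: norm_power power_less_one_iff)
  ultimately show False by simp
qed

text \<open>Both sides solve the same linear first-order equation on the unit disc and agree at 0: the
  quotient has derivative zero. A complex parameter is needed since the selection of every fourth
  coefficient evaluates the series at \<open>\<plusminus>\<i>\<rho>\<close>.\<close>

theorem mehler_formula:
  fixes x y :: real and r :: complex
  assumes r: "cmod r < 1"
  shows "(\<lambda>m. of_real (mehler_coeff x y m) * r ^ m) sums
     (exp ((2 * r * of_real (x * y) - r\<^sup>2 * of_real (x\<^sup>2 + y\<^sup>2)) / (1 - r\<^sup>2)) / csqrt (1 - r\<^sup>2))"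
proof -
  define Q where "Q = mehler_fps x y"
  define c d where "c = complex_of_real (2 * x * y)" and "d = complex_of_real (2 * (x\<^sup>2 + y\<^sup>2))"
  have rad: "fps_conv_radius Q \<ge> 1" unfolding Q_def by (rule fps_conv_radius_mehler)
  define E where "E z = (c * z - d / 2 * z\<^sup>2) / (1 - z\<^sup>2)" for z
  define \<Phi> where "\<Phi> z = eval_fps Q z * exp (- E z) * csqrt (1 - z\<^sup>2)" for z
  have "\<exists>K. \<forall>z\<in>ball 0 1. \<Phi> z = K"
  proof (rule has_field_derivative_zero_constant)
    fix z :: complex assume "z \<in> ball 0 1"
    hence z: "cmod z < 1" by simp
    have nz: "1 - z\<^sup>2 \<notin> \<real>\<^sub>\<le>\<^sub>0" by (rule one_minus_square_not_nonpos[OF z])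
    hence nz0: "1 - z\<^sup>2 \<noteq> 0" by force
    have zr: "ereal (norm z) < fps_conv_radius Q"
      using rad z by (metis ereal_less(3) less_le_trans)
    define S where "S = csqrt (1 - z\<^sup>2)"
    have S: "S \<noteq> 0" "S * S = 1 - z\<^sup>2"
      using nz0 by (auto simp: S_def simp flip: power2_eq_square)
    define Q' where "Q' = eval_fps (fps_deriv Q) z"
    have dQ: "(eval_fps Q has_field_derivative Q') (at z)"
      unfolding Q'_def by (rule has_field_derivative_eval_fps[OF zr])
    have dE: "(E has_field_derivative ((c - d * z) * (1 - z\<^sup>2) + (c * z - d / 2 * z\<^sup>2) * (2 * z)) / (1 - z\<^sup>2)\<^sup>2) (at z)"
      unfolding E_def using nz0
      by (auto intro!: derivative_eq_intros simp: power2_eq_square)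
    define E' where "E' = ((c - d * z) * (1 - z\<^sup>2) + (c * z - d / 2 * z\<^sup>2) * (2 * z)) / (1 - z\<^sup>2)\<^sup>2"
    have dC: "((\<lambda>z. csqrt (1 - z\<^sup>2)) has_field_derivative (- z / S)) (at z)"
      unfolding S_def using nz S
      by (auto intro!: derivative_eq_intros simp: S_def)
    have ode: "(1 - z\<^sup>2)\<^sup>2 * Q' = (z * (1 - z\<^sup>2) + c * (1 + z\<^sup>2) - d * z) * eval_fps Q z"
    proof -
      define P1 where "P1 = (1 - [:0, 1::complex:] ^ 2) ^ 2"
      define P2 where "P2 = [:0, 1:] * (1 - [:0, 1::complex:] ^ 2) + [:c:] * (1 + [:0, 1:] ^ 2)
        - [:d:] * [:0, 1:]"
      have p1: "(1 - fps_X ^ 2) ^ 2 = fps_of_poly P1"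
        by (simp add: P1_def fps_of_poly_diff fps_of_poly_power fps_of_poly_simps)
      have p2: "fps_X * (1 - fps_X ^ 2) + fps_const c * (1 + fps_X ^ 2) - fps_const d * fps_X
         = fps_of_poly P2"
        by (simp add: P2_def fps_of_poly_diff fps_of_poly_add fps_of_poly_mult fps_of_poly_power
            fps_of_poly_simps del: mult_pCons_left mult_pCons_right)
      have "fps_of_poly P1 * fps_deriv Q = fps_of_poly P2 * Q"
        using mehler_fps_ode[of x y] unfolding p1[symmetric] p2[symmetric] Q_def c_def d_def .
      hence "eval_fps (fps_of_poly P1 * fps_deriv Q) z = eval_fps (fps_of_poly P2 * Q) z"
        by simp
      moreover have "ereal (norm z) < fps_conv_radius (fps_deriv Q)"
        using zr fps_conv_radius_deriv[of Q] by (rule less_le_trans)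
      ultimately have "poly P1 z * Q' = poly P2 z * eval_fps Q z"
        using zr by (simp add: eval_fps_mult Q'_def)
      thus ?thesis by (simp add: P1_def P2_def mult_ac)
    qed
    have dX: "((\<lambda>z. exp (- E z)) has_field_derivative (exp (- E z) * - E')) (at z)"
      by (intro DERIV_fun_exp DERIV_minus dE[folded E'_def])
    have "(\<Phi> has_field_derivative
        eval_fps Q z * exp (- E z) * (- z / S)
          + (eval_fps Q z * (exp (- E z) * - E') + Q' * exp (- E z)) * S) (at z)"
      using DERIV_mult'[OF DERIV_mult'[OF dQ dX] dC] unfolding \<Phi>_def S_def[symmetric] .
    moreover have "eval_fps Q z * exp (- E z) * (- z / S)
          + (eval_fps Q z * (exp (- E z) * - E') + Q' * exp (- E z)) * S = 0"
    proof -
      define T where "T = (z * (1 - z\<^sup>2) + c * (1 + z\<^sup>2) - d * z) / (1 - z\<^sup>2)\<^sup>2"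
      have "(1 - z\<^sup>2)\<^sup>2 \<noteq> 0" using nz0 by simp
      hence Q': "Q' = T * eval_fps Q z"
        using ode unfolding T_def
        by (metis nonzero_mult_div_cancel_left times_divide_eq_left)
      have zS: "- z / S = - (z / (1 - z\<^sup>2)) * S" unfolding S(2)[symmetric]
        using S(1) by simp
      have "z / (1 - z\<^sup>2) = z * (1 - z\<^sup>2) / (1 - z\<^sup>2)\<^sup>2"
        using nz0 by (simp add: power2_eq_square)
      hence "T - E' - z / (1 - z\<^sup>2) = 0" unfolding E'_def T_def
        by (simp add: diff_divide_distrib[symmetric]) (simp add: algebra_simps power2_eq_square)
      moreover have "eval_fps Q z * exp (- E z) * (- z / S)
          + (eval_fps Q z * (exp (- E z) * - E') + Q' * exp (- E z)) * S =
         eval_fps Q z * exp (- E z) * S * (T - E' - z / (1 - z\<^sup>2))"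
        unfolding zS Q' by (simp only: ring_distribs mult_ac minus_mult_left[symmetric] 
            mult_minus_right diff_conv_add_uminus add_ac)
      ultimately show ?thesis by simp
    qed
    ultimately show "(\<Phi> has_field_derivative 0) (at z within ball 0 1)"
      by (simp add: has_field_derivative_at_within)
  qed simp
  then obtain K where K: "\<And>z. cmod z < 1 \<Longrightarrow> \<Phi> z = K" by auto
  have "\<Phi> 0 = 1"
    by (simp add: \<Phi>_def E_def eval_fps_at_0 Q_def mehler_fps_def mehler_coeff_initial(1))
  hence "\<Phi> r = 1" using K[of 0] K[OF r] by simp
  moreover have "csqrt (1 - r\<^sup>2) \<noteq> 0" using one_minus_square_not_nonpos[OF r] by force
  ultimately have "eval_fps Q r = exp (E r) / csqrt (1 - r\<^sup>2)"
    unfolding \<Phi>_def exp_minus by (simp add: field_simps)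
  moreover have "(\<lambda>m. fps_nth Q m * r ^ m) sums eval_fps Q r"
    using rad r by (intro sums_eval_fps) (metis ereal_less(3) less_le_trans)
  moreover have "E r = (2 * r * of_real (x * y) - r\<^sup>2 * of_real (x\<^sup>2 + y\<^sup>2)) / (1 - r\<^sup>2)"
    by (simp add: E_def c_def d_def algebra_simps)
  ultimately show ?thesis by (simp add: Q_def mehler_fps_def)
qed

section \<open>Orthonormality of the Hermite functions\<close>

lemma integrable_poly_gauss:
  fixes s :: real
  shows "integrable lborel (\<lambda>x. poly p (s * x) * exp (- (2 * pi * x\<^sup>2)))"
proof -
  have "integrable lborel (\<lambda>x. \<Sum>i\<le>degree p. coeff p i * s ^ i / sqrt 2 *
      (normal_density 0 (1 / (2 * sqrt pi)) x * (x - 0) ^ i))"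
    by (intro Bochner_Integration.integrable_sum integrable_mult_right integrable_normal_moment) simp
  also have "(\<lambda>x. \<Sum>i\<le>degree p. coeff p i * s ^ i / sqrt 2 *
      (normal_density 0 (1 / (2 * sqrt pi)) x * (x - 0) ^ i))
     = (\<lambda>x. poly p (s * x) * exp (- (2 * pi * x\<^sup>2)))"
  proof
    fix x
    have nd: "normal_density 0 (1 / (2 * sqrt pi)) x = sqrt 2 * exp (- (2 * pi * x\<^sup>2))"
      by (simp add: normal_density_def power_divide power_mult_distrib real_sqrt_divide field_simps)
    show "(\<Sum>i\<le>degree p. coeff p i * s ^ i / sqrt 2 *
      (normal_density 0 (1 / (2 * sqrt pi)) x * (x - 0) ^ i)) = poly p (s * x) * exp (- (2 * pi * x\<^sup>2))"
      unfolding nd poly_altdef sum_distrib_right by (intro sum.cong) (simp_all add: power_mult_distrib)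
  qed
  finally show ?thesis .
qed

lemma poly_gauss_tendsto_0:
  fixes s :: real
  assumes "F = at_top \<or> F = at_bot"
  shows "((\<lambda>x. poly p (s * x) * exp (- (2 * pi * x\<^sup>2))) \<longlongrightarrow> 0) F"
proof -
  have m: "((\<lambda>x::real. x ^ i * exp (- (2 * pi * x\<^sup>2))) \<longlongrightarrow> 0) F" for i
    using assms
  proof
    assume "F = at_top" thus ?thesis by (simp, real_asymp)
  next
    assume "F = at_bot"
    have "((\<lambda>x::real. (- x) ^ i * exp (- (2 * pi * x\<^sup>2))) \<longlongrightarrow> 0) at_top"
    proof (cases "even i")
      case True thus ?thesis by (simp, real_asymp)
    next
      case False thus ?thesis by (simp, real_asymp)
    qed
    thus ?thesis unfolding \<open>F = at_bot\<close> at_bot_mirror by (simp add: filterlim_filtermap)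
  qed
  have "((\<lambda>x. \<Sum>i\<le>degree p. coeff p i * s ^ i * (x ^ i * exp (- (2 * pi * x\<^sup>2))))
      \<longlongrightarrow> (\<Sum>i\<le>degree p. coeff p i * s ^ i * 0)) F"
    by (intro tendsto_intros m)
  thus ?thesis unfolding poly_altdef sum_distrib_right by (simp add: power_mult_distrib mult.assoc)
qed

definition gauss_integral :: "real poly \<Rightarrow> real" where
  "gauss_integral p = (LBINT x. poly p (sqrt (2 * pi) * x) * exp (- (2 * pi * x\<^sup>2)))"

lemma gauss_integral_add: "gauss_integral (p + q) = gauss_integral p + gauss_integral q"
  unfolding gauss_integral_def by (simp add: distrib_right Bochner_Integration.integral_add integrable_poly_gauss)

lemma gauss_integral_smult: "gauss_integral (smult c p) = c * gauss_integral p"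
  unfolding gauss_integral_def by (simp add: mult.assoc)

lemma gauss_integral_1: "gauss_integral 1 = 1 / sqrt 2"
proof -
  have nd: "normal_density 0 (1 / (2 * sqrt pi)) x = sqrt 2 * exp (- (2 * pi * x\<^sup>2))" for x
    by (simp add: normal_density_def power_divide power_mult_distrib real_sqrt_divide field_simps)
  have "(LBINT x. normal_density 0 (1 / (2 * sqrt pi)) x) = 1"
    by (rule integral_normal_density) simp
  thus ?thesis unfolding nd gauss_integral_def by (simp add: field_simps)
qed

text \<open>The integrand is, up to a constant factor, the derivative of \<open>p(z) exp(-z\<^sup>2)\<close> with
  \<open>z = \<surd>(2\<pi>) x\<close>, which vanishes at infinity. In particular the raising operator
  \<open>p \<mapsto> 2 z p - p'\<close> is the adjoint of differentiation.\<close>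

lemma gauss_integral_by_parts: "gauss_integral ([:0, 2:] * p - pderiv p) = 0"
proof -
  define s where "s = sqrt (2 * pi)"
  have s: "s > 0" "s * s = 2 * pi" by (simp_all add: s_def)
  let ?F = "\<lambda>x. poly p (s * x) * exp (- (2 * pi * x\<^sup>2))"
  let ?f = "\<lambda>x. - s * (poly ([:0, 2:] * p - pderiv p) (s * x) * exp (- (2 * pi * x\<^sup>2)))"
  have "(LBINT x=-\<infinity>..\<infinity>. ?f x) = 0 - 0"
  proof (rule interval_integral_FTC_integrable)
    fix x :: real
    have "(?F has_real_derivative
        poly (pderiv p) (s * x) * s * exp (- (2 * pi * x\<^sup>2))
          + poly p (s * x) * (exp (- (2 * pi * x\<^sup>2)) * (- 4 * pi * x))) (at x)"
      by (auto intro!: derivative_eq_intros DERIV_chain2[OF poly_DERIV])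
    moreover have "exp (- (2 * pi * x\<^sup>2)) * (- 4 * pi * x) = exp (- (2 * pi * x\<^sup>2)) * (- 2 * (s * s) * x)"
      using s by simp
    ultimately have "(?F has_real_derivative ?f x) (at x)"
      by (simp only:) (simp add: algebra_simps)
    thus "(?F has_vector_derivative ?f x) (at x)"
      by (simp add: has_real_derivative_iff_has_vector_derivative)
    show "isCont ?f x" by (intro continuous_intros)
  next
    show "set_integrable lborel (einterval (-\<infinity>) \<infinity>) ?f"
      using integrable_poly_gauss[of "[:0, 2:] * p - pderiv p" s]
      by (simp add: einterval_def set_integrable_def del: mult_pCons_left)
  next
    show "((?F \<circ> real_of_ereal) \<longlongrightarrow> 0) (at_right (-\<infinity>))"
      unfolding at_right_MInf o_def filterlim_filtermap real_of_ereal.simps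
      by (rule poly_gauss_tendsto_0) simp
    show "((?F \<circ> real_of_ereal) \<longlongrightarrow> 0) (at_left \<infinity>)"
      unfolding at_left_PInf o_def filterlim_filtermap real_of_ereal.simps
      by (rule poly_gauss_tendsto_0) simp
  qed simp
  hence "(LBINT x. ?f x) = 0"
    by (simp add: interval_lebesgue_integral_def einterval_def set_lebesgue_integral_def)
  thus ?thesis using s unfolding gauss_integral_def s_def[symmetric] by simp
qed

text \<open>Raising operators are moved from one factor to the other, where they become derivatives and lower
  the index, until one index is 0.\<close>

lemma gauss_integral_hermite:
  "gauss_integral (hermite_poly m * hermite_poly n) = (if m = n then 2 ^ m * fact m / sqrt 2 else 0)"
proof -
  have step: "gauss_integral (hermite_poly (Suc m) * p) = gauss_integral (hermite_poly m * pderiv p)" for m p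
  proof -
    have "hermite_poly (Suc m) * p =
        ([:0, 2:] * (hermite_poly m * p) - pderiv (hermite_poly m * p)) + hermite_poly m * pderiv p"
      by (simp add: pderiv_mult algebra_simps)
    thus ?thesis by (simp add: gauss_integral_add gauss_integral_by_parts del: mult_pCons_left)
  qed
  have main: "gauss_integral (hermite_poly m * hermite_poly n) =
      (if m = n then 2 ^ m * fact m / sqrt 2 else 0)" if "n \<le> m" for m n
    using that
  proof (induction m arbitrary: n)
    case 0 thus ?case by (simp add: gauss_integral_1)
  next
    case (Suc m)
    show ?case
    proof (cases n)
      case 0 thus ?thesis unfolding step by (simp add: gauss_integral_def)
    next
      case (Suc k)
      thus ?thesis unfolding step using Suc.IH[of k] Suc.prems
        by (simp add: pderiv_hermite_poly gauss_integral_smult del: hermite_poly.simps)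
    qed
  qed
  show ?thesis using main[of n m] main[of m n] by (cases "n \<le> m") (auto simp: mult.commute)
qed

lemma hermite_fun_mult:
  "hermite_fun m x * hermite_fun n x = sqrt 2 / (sqrt (2 ^ m * fact m) * sqrt (2 ^ n * fact n)) *
     (poly (hermite_poly m * hermite_poly n) (sqrt (2 * pi) * x) * exp (- (2 * pi * x\<^sup>2)))"
proof -
  have "2 powr (1/4) * 2 powr (1/4) = (sqrt 2 :: real)"
    by (simp add: powr_add[symmetric] powr_half_sqrt)
  moreover have "exp (- pi * x\<^sup>2) * exp (- pi * x\<^sup>2) = exp (- (2 * pi * x\<^sup>2))"
    by (simp add: exp_add[symmetric])
  ultimately show ?thesis unfolding hermite_fun_def
    by (simp add: mult_ac)
qed

lemma integrable_hermite_fun_mult: "integrable lborel (\<lambda>x. hermite_fun m x * hermite_fun n x)"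
  unfolding hermite_fun_mult by (intro integrable_mult_right integrable_poly_gauss)

lemma hermite_fun_orthonormal:
  "(LBINT x. hermite_fun m x * hermite_fun n x) = (if m = n then 1 else 0)"
  unfolding hermite_fun_mult
  using gauss_integral_hermite[of m n] unfolding gauss_integral_def
  by simp

lemma continuous_hermite_fun [continuous_intros]:
  "continuous_on A f \<Longrightarrow> continuous_on A (\<lambda>x. hermite_fun m (f x))"
  unfolding hermite_fun_def by (intro continuous_intros)

lemma hermite_fun_borel [measurable]: "hermite_fun m \<in> borel_measurable borel"
  by (intro borel_measurable_continuous_onI continuous_intros)

lemma integral_hermite_sum_square:
  assumes "finite J"
  shows "integrable lborel (\<lambda>x. (\<Sum>j\<in>J. c j * hermite_fun (4 * j) x)\<^sup>2)"
    and "(LBINT x. (\<Sum>j\<in>J. c j * hermite_fun (4 * j) x)\<^sup>2) = (\<Sum>j\<in>J. (c j)\<^sup>2)"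
proof -
  have eq: "(\<Sum>j\<in>J. c j * hermite_fun (4 * j) x)\<^sup>2 =
      (\<Sum>i\<in>J. \<Sum>j\<in>J. c i * c j * (hermite_fun (4 * i) x * hermite_fun (4 * j) x))" for x
    by (simp add: power2_eq_square sum_product mult_ac)
  show "integrable lborel (\<lambda>x. (\<Sum>j\<in>J. c j * hermite_fun (4 * j) x)\<^sup>2)"
    unfolding eq by (intro Bochner_Integration.integrable_sum integrable_mult_right integrable_hermite_fun_mult)
  show "(LBINT x. (\<Sum>j\<in>J. c j * hermite_fun (4 * j) x)\<^sup>2) = (\<Sum>j\<in>J. (c j)\<^sup>2)"
    unfolding eq using assms
    by (simp add: integrable_hermite_fun_mult hermite_fun_orthonormal power2_eq_square if_distrib cong: if_cong)
qed

section \<open>The kernels at fixed time\<close>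

lemma i_power_sum: "1 + (- 1) ^ m + \<i> ^ m + (- \<i>) ^ m = (if 4 dvd m then 4 else 0)"
proof -
  have m: "m = 4 * (m div 4) + m mod 4" by simp
  have p: "(w::complex) ^ 4 = 1 \<Longrightarrow> w ^ m = w ^ (m mod 4)" for w
    by (subst m) (simp only: power_add power_mult power_one mult_1)
  have e: "(- 1 :: complex) ^ 4 = 1" "\<i> ^ 4 = 1" "(- \<i>) ^ 4 = 1" by simp_all
  have "m mod 4 < 4" by simp
  then consider "m mod 4 = 0" | "m mod 4 = 1" | "m mod 4 = 2" | "m mod 4 = 3" by linarith
  thus ?thesis unfolding p[OF e(1)] p[OF e(2)] p[OF e(3)]
    by cases (simp_all add: dvd_eq_mod_eq_0 power3_eq_cube)
qed

text \<open>The average over the fourth roots of unity selects the indices divisible by 4. The two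
  real rotations give the main terms; for the two imaginary ones the exponent has real part
  \<open>\<rho>\<^sup>2(x\<^sup>2 + y\<^sup>2) / (1 + \<rho>\<^sup>2)\<close> and the denominator has modulus at least 1, which bounds the error.\<close>

lemma mehler_section:
  fixes \<rho> x y :: real
  assumes \<rho>: "0 \<le> \<rho>" "\<rho> < 1"
  defines "E \<equiv> \<lambda>r. exp ((2 * r * (x * y) - r\<^sup>2 * (x\<^sup>2 + y\<^sup>2)) / (1 - r\<^sup>2))"
  obtains S where "(\<lambda>j. mehler_coeff x y (4 * j) * \<rho> ^ (4 * j)) sums S"
    "\<bar>S - (E \<rho> + E (- \<rho>)) / (4 * sqrt (1 - \<rho>\<^sup>2))\<bar> \<le> exp (\<rho>\<^sup>2 * (x\<^sup>2 + y\<^sup>2) / (1 + \<rho>\<^sup>2)) / 2"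
proof -
  define M :: "complex \<Rightarrow> complex" where "M r =
    exp ((2 * r * of_real (x * y) - r\<^sup>2 * of_real (x\<^sup>2 + y\<^sup>2)) / (1 - r\<^sup>2)) / csqrt (1 - r\<^sup>2)" for r
  let ?q = "\<lambda>m. complex_of_real (mehler_coeff x y m)"
  have \<rho>2: "\<rho>\<^sup>2 < 1" using \<rho> by (simp add: power_less_one_iff)
  have M: "(\<lambda>m. ?q m * (w * of_real \<rho>) ^ m) sums M (w * of_real \<rho>)" if "cmod w = 1" for w
    unfolding M_def by (rule mehler_formula) (use \<rho> that in \<open>simp add: norm_mult\<close>)
  have Mreal: "M (of_real r) = of_real (E r / sqrt (1 - r\<^sup>2))" if "r\<^sup>2 < 1" for r :: real
  proof -
    have c: "csqrt (1 - (of_real r)\<^sup>2) = of_real (sqrt (1 - r\<^sup>2))"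
    proof -
      have "1 - (of_real r)\<^sup>2 = complex_of_real (1 - r\<^sup>2)" by simp
      thus ?thesis using that by (simp only: csqrt_of_real)
    qed
    have "(2 * of_real r * of_real (x * y) - (of_real r)\<^sup>2 * of_real (x\<^sup>2 + y\<^sup>2)) / (1 - (of_real r)\<^sup>2) =
       complex_of_real ((2 * r * (x * y) - r\<^sup>2 * (x\<^sup>2 + y\<^sup>2)) / (1 - r\<^sup>2))"
      by simp
    thus ?thesis unfolding M_def E_def c by (simp only: exp_of_real) (simp only: of_real_divide)
  qed
  have Mim: "cmod (M (w * of_real \<rho>)) \<le> exp (\<rho>\<^sup>2 * (x\<^sup>2 + y\<^sup>2) / (1 + \<rho>\<^sup>2))" if "w = \<i> \<or> w = - \<i>" for w
  proof -
    have w2: "1 - (w * of_real \<rho>)\<^sup>2 = complex_of_real (1 + \<rho>\<^sup>2)"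
      "- ((w * of_real \<rho>)\<^sup>2) = complex_of_real (\<rho>\<^sup>2)"
      using that by (auto simp: power_mult_distrib)
    have Re: "Re (2 * (w * of_real \<rho>) * of_real (x * y)) = 0" using that by auto
    have "cmod (csqrt (1 - (w * of_real \<rho>)\<^sup>2)) = sqrt (1 + \<rho>\<^sup>2)"
      unfolding w2 by (subst csqrt_of_real) auto
    moreover have "cmod (exp ((2 * (w * of_real \<rho>) * of_real (x * y) - (w * of_real \<rho>)\<^sup>2 * of_real (x\<^sup>2 + y\<^sup>2))
         / (1 - (w * of_real \<rho>)\<^sup>2))) = exp (\<rho>\<^sup>2 * (x\<^sup>2 + y\<^sup>2) / (1 + \<rho>\<^sup>2))"
    proof -
      have "(2 * (w * of_real \<rho>) * of_real (x * y) - (w * of_real \<rho>)\<^sup>2 * of_real (x\<^sup>2 + y\<^sup>2)) =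
          2 * (w * of_real \<rho>) * of_real (x * y) + of_real (\<rho>\<^sup>2 * (x\<^sup>2 + y\<^sup>2))"
        using that by (auto simp: power_mult_distrib)
      thus ?thesis unfolding w2 norm_exp_eq_Re
        using Re by (simp only: Re_divide_of_real plus_complex.sel Re_complex_of_real)
          (simp add: algebra_simps)
    qed
    ultimately show ?thesis unfolding M_def norm_divide
      by (simp add: divide_le_eq mult_le_cancel_left1)
        (use zero_le_power2[of \<rho>] in linarith)
  qed
  define Z where "Z = (M (of_real \<rho>) + M (of_real (- \<rho>)) + M (\<i> * of_real \<rho>) + M (- \<i> * of_real \<rho>)) / 4"
  have "(\<lambda>m. (?q m * (1 * of_real \<rho>) ^ m + ?q m * (- 1 * of_real \<rho>) ^ m + ?q m * (\<i> * of_real \<rho>) ^ m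
      + ?q m * (- \<i> * of_real \<rho>) ^ m) / 4) sums
      ((M (1 * of_real \<rho>) + M (- 1 * of_real \<rho>) + M (\<i> * of_real \<rho>) + M (- \<i> * of_real \<rho>)) / 4)"
    by (intro sums_divide sums_add M) auto
  also have "(\<lambda>m. (?q m * (1 * of_real \<rho>) ^ m + ?q m * (- 1 * of_real \<rho>) ^ m + ?q m * (\<i> * of_real \<rho>) ^ m
      + ?q m * (- \<i> * of_real \<rho>) ^ m) / 4) =
      (\<lambda>m. if 4 dvd m then complex_of_real (mehler_coeff x y m * \<rho> ^ m) else 0)"
  proof
    fix m
    have "(?q m * (1 * of_real \<rho>) ^ m + ?q m * (- 1 * of_real \<rho>) ^ m + ?q m * (\<i> * of_real \<rho>) ^ m
      + ?q m * (- \<i> * of_real \<rho>) ^ m) / 4 =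
       ?q m * of_real \<rho> ^ m * (1 + (- 1) ^ m + \<i> ^ m + (- \<i>) ^ m) / 4"
      by (simp only: power_mult_distrib) (simp add: algebra_simps)
    also have "\<dots> = (if 4 dvd m then complex_of_real (mehler_coeff x y m * \<rho> ^ m) else 0)"
      unfolding i_power_sum by simp
    finally show "(?q m * (1 * of_real \<rho>) ^ m + ?q m * (- 1 * of_real \<rho>) ^ m + ?q m * (\<i> * of_real \<rho>) ^ m
      + ?q m * (- \<i> * of_real \<rho>) ^ m) / 4 =
      (if 4 dvd m then complex_of_real (mehler_coeff x y m * \<rho> ^ m) else 0)" .
  qed
  finally have "(\<lambda>m. if 4 dvd m then complex_of_real (mehler_coeff x y m * \<rho> ^ m) else 0) sums Z"
    by (simp add: Z_def)
  hence "(\<lambda>j. if 4 dvd (4 * j) then complex_of_real (mehler_coeff x y (4 * j) * \<rho> ^ (4 * j)) else 0) sums Z"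
    by (subst sums_mono_reindex[of "\<lambda>j. 4 * j"]) (auto simp: strict_mono_def elim!: dvdE)
  hence sZ: "(\<lambda>j. complex_of_real (mehler_coeff x y (4 * j) * \<rho> ^ (4 * j))) sums Z" by simp
  hence "(\<lambda>j. Re (complex_of_real (mehler_coeff x y (4 * j) * \<rho> ^ (4 * j)))) sums Re Z"
    by (rule sums_Re)
  hence S: "(\<lambda>j. mehler_coeff x y (4 * j) * \<rho> ^ (4 * j)) sums Re Z" by simp
  define T where "T = (M (\<i> * of_real \<rho>) + M (- \<i> * of_real \<rho>)) / 4"
  have "Z = of_real ((E \<rho> + E (- \<rho>)) / (4 * sqrt (1 - \<rho>\<^sup>2))) + T"
    unfolding Z_def T_def using \<rho>2 by (subst (1 2) Mreal) (simp_all add: field_simps)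
  hence "Re Z - (E \<rho> + E (- \<rho>)) / (4 * sqrt (1 - \<rho>\<^sup>2)) = Re T" by simp
  moreover have "\<bar>Re T\<bar> \<le> cmod T" by (rule abs_Re_le_cmod)
  moreover have "cmod T \<le> exp (\<rho>\<^sup>2 * (x\<^sup>2 + y\<^sup>2) / (1 + \<rho>\<^sup>2)) / 2"
    using Mim[of \<i>] Mim[of "- \<i>"] norm_triangle_ineq[of "M (\<i> * of_real \<rho>)" "M (- \<i> * of_real \<rho>)"]
    unfolding T_def norm_divide by simp
  ultimately show ?thesis using S that by simp
qed

lemma hermite_fun_mult_mehler:
  "hermite_fun m x * hermite_fun m y = sqrt 2 * exp (- (pi * (x\<^sup>2 + y\<^sup>2))) *
     mehler_coeff (sqrt (2 * pi) * x) (sqrt (2 * pi) * y) m"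
proof -
  have "2 powr (1/4) * 2 powr (1/4) = (sqrt 2 :: real)"
    by (simp add: powr_add[symmetric] powr_half_sqrt)
  moreover have "exp (- pi * x\<^sup>2) * exp (- pi * y\<^sup>2) = exp (- (pi * (x\<^sup>2 + y\<^sup>2)))"
    by (simp add: exp_add[symmetric] algebra_simps)
  moreover have "sqrt (2 ^ m * fact m) * sqrt (2 ^ m * fact m) = (2 ^ m * fact m :: real)"
    by simp
  moreover have "hermite_fun m x * hermite_fun m y = (2 powr (1/4) * 2 powr (1/4)) *
      (exp (- pi * x\<^sup>2) * exp (- pi * y\<^sup>2)) *
      (poly (hermite_poly m) (sqrt (2 * pi) * x) * poly (hermite_poly m) (sqrt (2 * pi) * y))
        / (sqrt (2 ^ m * fact m) * sqrt (2 ^ m * fact m))"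
    unfolding hermite_fun_def by simp
  ultimately show ?thesis unfolding mehler_coeff_def by simp
qed

text \<open>This is the heat kernel of the harmonic oscillator, restricted to the eigenspaces with index
  divisible by 4 and with the time scale and ground state energy normalized.\<close>

definition heat :: "real \<Rightarrow> real \<Rightarrow> real \<Rightarrow> real" where
  "heat t x y = (\<Sum>j. exp (- (real j * t)) * (hermite_fun (4 * j) x * hermite_fun (4 * j) y))"

text \<open>The parameter of Mehler's formula is \<open>\<rho> = exp(-t/4)\<close>. After multiplication with the Gaussians
  of the Hermite functions, completing squares turns both main exponents into nonpositive
  expressions.\<close>

lemma heat_formula:
  fixes t x y :: real
  assumes t: "0 < t"
  defines "\<rho> \<equiv> exp (- t / 4)"
  defines "G \<equiv> \<lambda>z. exp (- (2 * pi * \<rho> * z\<^sup>2 / (1 - \<rho>\<^sup>2)) - pi * ((1 - \<rho>) / (1 + \<rho>)) * (x\<^sup>2 + y\<^sup>2))"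
  shows "(\<lambda>j. exp (- (real j * t)) * (hermite_fun (4 * j) x * hermite_fun (4 * j) y)) sums heat t x y"
    and "\<bar>heat t x y - sqrt 2 / (4 * sqrt (1 - \<rho>\<^sup>2)) * (G (x - y) + G (x + y))\<bar>
      \<le> sqrt 2 / 2 * exp (- (pi * ((1 - \<rho>\<^sup>2) / (1 + \<rho>\<^sup>2)) * (x\<^sup>2 + y\<^sup>2)))"
proof -
  have \<rho>: "0 < \<rho>" "\<rho> < 1" using t by (simp_all add: \<rho>_def)
  hence \<rho>2: "\<rho>\<^sup>2 < 1" by (simp add: power_less_one_iff)
  define X Y where "X = sqrt (2 * pi) * x" and "Y = sqrt (2 * pi) * y"
  have XY: "X * Y = 2 * pi * (x * y)" "X\<^sup>2 + Y\<^sup>2 = 2 * pi * (x\<^sup>2 + y\<^sup>2)"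
    by (simp_all add: X_def Y_def power_mult_distrib algebra_simps)
  define E where "E r = exp ((2 * r * (X * Y) - r\<^sup>2 * (X\<^sup>2 + Y\<^sup>2)) / (1 - r\<^sup>2))" for r
  obtain S where S: "(\<lambda>j. mehler_coeff X Y (4 * j) * \<rho> ^ (4 * j)) sums S"
    "\<bar>S - (E \<rho> + E (- \<rho>)) / (4 * sqrt (1 - \<rho>\<^sup>2))\<bar> \<le> exp (\<rho>\<^sup>2 * (X\<^sup>2 + Y\<^sup>2) / (1 + \<rho>\<^sup>2)) / 2"
    unfolding E_def by (rule mehler_section[OF less_imp_le[OF \<rho>(1)] \<rho>(2), of X Y])
  define c where "c = sqrt 2 * exp (- (pi * (x\<^sup>2 + y\<^sup>2)))"
  have c0: "c \<ge> 0" by (simp add: c_def)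
  have "(\<lambda>j. c * (mehler_coeff X Y (4 * j) * \<rho> ^ (4 * j))) sums (c * S)"
    by (rule sums_mult[OF S(1)])
  moreover have "c * (mehler_coeff X Y (4 * j) * \<rho> ^ (4 * j)) =
      exp (- (real j * t)) * (hermite_fun (4 * j) x * hermite_fun (4 * j) y)" for j
  proof -
    have "\<rho> ^ (4 * j) = exp (- (real j * t))"
      unfolding \<rho>_def exp_of_nat_mult[symmetric] by (simp add: mult.commute)
    thus ?thesis unfolding hermite_fun_mult_mehler c_def X_def Y_def by simp
  qed
  ultimately have s: "(\<lambda>j. exp (- (real j * t)) * (hermite_fun (4 * j) x * hermite_fun (4 * j) y)) sums (c * S)"
    by simp
  hence h: "heat t x y = c * S" unfolding heat_def by (rule sums_unique[symmetric])
  show "(\<lambda>j. exp (- (real j * t)) * (hermite_fun (4 * j) x * hermite_fun (4 * j) y)) sums heat t x y"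
    using s unfolding h .
  have cE: "c * E r = sqrt 2 * exp (- (2 * pi * \<rho> * z\<^sup>2 / (1 - \<rho>\<^sup>2)) - pi * ((1 - \<rho>) / (1 + \<rho>)) * (x\<^sup>2 + y\<^sup>2))"
    if "r = \<rho> \<and> z = x - y \<or> r = - \<rho> \<and> z = x + y" for r z
  proof -
    have nz: "1 - \<rho>\<^sup>2 \<noteq> 0" using \<rho>2 by simp
    have a: "(1 - \<rho>) / (1 + \<rho>) = (1 - \<rho>)\<^sup>2 / (1 - \<rho>\<^sup>2)"
      using \<rho> nz by (simp add: power2_eq_square divide_simps) (simp add: algebra_simps)
    have r2: "r\<^sup>2 = \<rho>\<^sup>2" using that by auto
    have "- (pi * (x\<^sup>2 + y\<^sup>2)) + (2 * r * (X * Y) - r\<^sup>2 * (X\<^sup>2 + Y\<^sup>2)) / (1 - r\<^sup>2) =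
       (- (pi * (x\<^sup>2 + y\<^sup>2)) * (1 - \<rho>\<^sup>2) + (2 * r * (X * Y) - \<rho>\<^sup>2 * (X\<^sup>2 + Y\<^sup>2))) / (1 - \<rho>\<^sup>2)"
      unfolding r2 add_divide_distrib using nz by simp
    also have "- (pi * (x\<^sup>2 + y\<^sup>2)) * (1 - \<rho>\<^sup>2) + (2 * r * (X * Y) - \<rho>\<^sup>2 * (X\<^sup>2 + Y\<^sup>2)) =
       - (2 * pi * \<rho> * z\<^sup>2) - pi * (1 - \<rho>)\<^sup>2 * (x\<^sup>2 + y\<^sup>2)"
      unfolding XY using that by (auto simp: power2_eq_square algebra_simps)
    also have "(- (2 * pi * \<rho> * z\<^sup>2) - pi * (1 - \<rho>)\<^sup>2 * (x\<^sup>2 + y\<^sup>2)) / (1 - \<rho>\<^sup>2) =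
       - (2 * pi * \<rho> * z\<^sup>2 / (1 - \<rho>\<^sup>2)) - pi * ((1 - \<rho>) / (1 + \<rho>)) * (x\<^sup>2 + y\<^sup>2)"
      unfolding a by (simp add: diff_divide_distrib)
    finally show ?thesis unfolding c_def E_def by (simp add: exp_add[symmetric] mult.assoc)
  qed
  have "c * ((E \<rho> + E (- \<rho>)) / (4 * sqrt (1 - \<rho>\<^sup>2))) = (c * E \<rho> + c * E (- \<rho>)) / (4 * sqrt (1 - \<rho>\<^sup>2))"
    by (simp add: distrib_left)
  also have "\<dots> = sqrt 2 / (4 * sqrt (1 - \<rho>\<^sup>2)) * (G (x - y) + G (x + y))"
    unfolding cE[of \<rho> "x - y", simplified] cE[of "- \<rho>" "x + y", simplified] G_def
    by (simp add: distrib_left add_divide_distrib)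
  finally have eq: "c * ((E \<rho> + E (- \<rho>)) / (4 * sqrt (1 - \<rho>\<^sup>2))) =
      sqrt 2 / (4 * sqrt (1 - \<rho>\<^sup>2)) * (G (x - y) + G (x + y))" .
  have pos: "1 + \<rho>\<^sup>2 > 0" by (simp add: add_pos_nonneg)
  have "- (pi * (x\<^sup>2 + y\<^sup>2)) + \<rho>\<^sup>2 * (X\<^sup>2 + Y\<^sup>2) / (1 + \<rho>\<^sup>2) = - (pi * ((1 - \<rho>\<^sup>2) / (1 + \<rho>\<^sup>2)) * (x\<^sup>2 + y\<^sup>2))"
    unfolding XY using pos by (simp add: divide_simps) (simp add: algebra_simps)
  hence hat: "c * (exp (\<rho>\<^sup>2 * (X\<^sup>2 + Y\<^sup>2) / (1 + \<rho>\<^sup>2)) / 2) =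
      sqrt 2 / 2 * exp (- (pi * ((1 - \<rho>\<^sup>2) / (1 + \<rho>\<^sup>2)) * (x\<^sup>2 + y\<^sup>2)))"
    unfolding c_def by (simp add: exp_add[symmetric] mult.assoc)
  have "\<bar>c * S - c * ((E \<rho> + E (- \<rho>)) / (4 * sqrt (1 - \<rho>\<^sup>2)))\<bar> \<le> c * (exp (\<rho>\<^sup>2 * (X\<^sup>2 + Y\<^sup>2) / (1 + \<rho>\<^sup>2)) / 2)"
    unfolding right_diff_distrib[symmetric] abs_mult using mult_left_mono[OF S(2) c0] c0 by simp
  thus "\<bar>heat t x y - sqrt 2 / (4 * sqrt (1 - \<rho>\<^sup>2)) * (G (x - y) + G (x + y))\<bar>
      \<le> sqrt 2 / 2 * exp (- (pi * ((1 - \<rho>\<^sup>2) / (1 + \<rho>\<^sup>2)) * (x\<^sup>2 + y\<^sup>2)))"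
    unfolding eq hat h .
qed

lemma heat_parameter_bounds:
  fixes t :: real
  assumes t: "0 < t" "t \<le> 1"
  defines "\<rho> \<equiv> exp (- t / 4)"
  shows "1/2 \<le> \<rho>" "\<rho> < 1" "t / 4 \<le> 1 - \<rho>\<^sup>2" "1 - \<rho>\<^sup>2 \<le> t / 2"
    "t / 16 \<le> (1 - \<rho>) / (1 + \<rho>)" "(1 - \<rho>) / (1 + \<rho>) \<le> t / 4"
    "t / 8 \<le> (1 - \<rho>\<^sup>2) / (1 + \<rho>\<^sup>2)"
proof -
  have lower: "u / 2 \<le> 1 - exp (- u)" if "0 \<le> u" "u \<le> 1" for u :: real
  proof -
    have "exp (- u) \<le> 1 / (1 + u)"
      using exp_ge_add_one_self[of u] that by (simp add: exp_minus field_simps)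
    also have "1 / (1 + u) \<le> 1 - u / 2"
      using that mult_left_mono[of u 1 u] by (simp add: field_simps)
    finally show ?thesis by simp
  qed
  have upper: "1 - exp (- u) \<le> u" for u :: real
    using exp_ge_add_one_self[of "- u"] by simp
  have \<rho>2: "\<rho>\<^sup>2 = exp (- (t / 2))"
    unfolding \<rho>_def by (simp add: power2_eq_square exp_add[symmetric])
  have \<rho>1: "\<rho> = exp (- (t / 4))" by (simp add: \<rho>_def)
  show b1: "\<rho> < 1" using t by (simp add: \<rho>_def)
  show b0: "1/2 \<le> \<rho>" using upper[of "t / 4"] t unfolding \<rho>1 by simp
  show b2: "t / 4 \<le> 1 - \<rho>\<^sup>2" using lower[of "t / 2"] t unfolding \<rho>2 by simp
  show "1 - \<rho>\<^sup>2 \<le> t / 2" using upper[of "t / 2"] unfolding \<rho>2 by simp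
  have l: "t / 8 \<le> 1 - \<rho>" and u: "1 - \<rho> \<le> t / 4"
    using lower[of "t / 4"] upper[of "t / 4"] t unfolding \<rho>1 by simp_all
  have "t / 16 * (1 + \<rho>) \<le> t / 16 * 2" using b1 t by (intro mult_left_mono) auto
  hence "t / 16 * (1 + \<rho>) \<le> 1 - \<rho>" using l by simp
  thus "t / 16 \<le> (1 - \<rho>) / (1 + \<rho>)" using b0 by (subst pos_le_divide_eq) auto
  have "t / 4 * 1 \<le> t / 4 * (1 + \<rho>)" using b0 t by (intro mult_left_mono) auto
  hence "1 - \<rho> \<le> t / 4 * (1 + \<rho>)" using u by simp
  thus "(1 - \<rho>) / (1 + \<rho>) \<le> t / 4" using b0 by (subst pos_divide_le_eq) auto
  have p: "1 + \<rho>\<^sup>2 > 0" by (simp add: add_pos_nonneg)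
  have "t / 8 * (1 + \<rho>\<^sup>2) \<le> t / 8 * 2" using t by (intro mult_left_mono) (auto simp: \<rho>2)
  hence "t / 8 * (1 + \<rho>\<^sup>2) \<le> 1 - \<rho>\<^sup>2" using b2 by simp
  thus "t / 8 \<le> (1 - \<rho>\<^sup>2) / (1 + \<rho>\<^sup>2)" using p by (subst pos_le_divide_eq) auto
qed

text \<open>The explicit form of \<open>heat_formula\<close> with \<open>1 - \<rho>\<^sup>2\<close> and \<open>1 - \<rho>\<close> replaced by multiples of \<open>t\<close>.
  For the lower bound the Gaussian in \<open>x + y\<close>, which is positive, is dropped.\<close>

lemma heat_bounds:
  assumes t: "0 < t" "t \<le> 1"
  shows heat_lower: "exp (- (8 * pi * (x - y)\<^sup>2 / t) - pi * t * (x\<^sup>2 + y\<^sup>2) / 4) / (2 * sqrt t)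
      - exp (- (t * (x\<^sup>2 + y\<^sup>2) / 4)) \<le> heat t x y"
    and heat_upper: "heat t x x \<le> 3 / sqrt t * exp (- (t * x\<^sup>2 / 4))"
proof -
  define \<rho> where "\<rho> = exp (- t / 4)"
  note b = heat_parameter_bounds[OF t, folded \<rho>_def]
  define G where "G x y z = exp (- (2 * pi * \<rho> * z\<^sup>2 / (1 - \<rho>\<^sup>2)) - pi * ((1 - \<rho>) / (1 + \<rho>)) * (x\<^sup>2 + y\<^sup>2))" for x y z
  define H where "H x y = sqrt 2 / 2 * exp (- (pi * ((1 - \<rho>\<^sup>2) / (1 + \<rho>\<^sup>2)) * (x\<^sup>2 + y\<^sup>2)))" for x y
  define A where "A = sqrt 2 / (4 * sqrt (1 - \<rho>\<^sup>2))"
  have heat: "\<bar>heat t x y - A * (G x y (x - y) + G x y (x + y))\<bar> \<le> H x y" for x y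
    using heat_formula(2)[OF t(1), of x y] unfolding \<rho>_def[symmetric] G_def A_def H_def .
  have pi: "pi > 3" by (rule pi_gt3)
  have H: "H x y \<le> exp (- (t * (x\<^sup>2 + y\<^sup>2) / 4))" for x y
  proof -
    have "t / 4 \<le> 3 * (t / 8)" using t by simp
    also have "\<dots> \<le> pi * ((1 - \<rho>\<^sup>2) / (1 + \<rho>\<^sup>2))" using b t pi by (intro mult_mono) auto
    finally have "t / 4 * (x\<^sup>2 + y\<^sup>2) \<le> pi * ((1 - \<rho>\<^sup>2) / (1 + \<rho>\<^sup>2)) * (x\<^sup>2 + y\<^sup>2)"
      by (rule mult_right_mono) simp
    hence "H x y \<le> sqrt 2 / 2 * exp (- (t / 4 * (x\<^sup>2 + y\<^sup>2)))"
      unfolding H_def by (intro mult_left_mono) auto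
    also have "\<dots> \<le> 1 * exp (- (t / 4 * (x\<^sup>2 + y\<^sup>2)))"
      using sqrt2_less_2 by (intro mult_right_mono) auto
    finally show ?thesis by simp
  qed
  have sq: "sqrt t / 2 \<le> sqrt (1 - \<rho>\<^sup>2)" "sqrt (1 - \<rho>\<^sup>2) \<le> sqrt t / sqrt 2"
    using real_sqrt_le_mono[OF b(3)] real_sqrt_le_mono[OF b(4)] by (simp_all add: real_sqrt_divide)
  have st: "0 < sqrt t" using t by simp
  have sr: "0 < sqrt (1 - \<rho>\<^sup>2)" using sq st by linarith
  have A1: "A \<le> sqrt 2 / (2 * sqrt t)"
    unfolding A_def using sq st sr by (intro divide_left_mono mult_pos_pos) auto
  have "sqrt 2 / (4 * (sqrt t / sqrt 2)) \<le> A"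
    unfolding A_def using sq st sr by (intro divide_left_mono mult_left_mono mult_pos_pos) auto
  hence A2: "1 / (2 * sqrt t) \<le> A" by simp
  have A0: "A \<ge> 0" unfolding A_def using sr by simp
  show "exp (- (8 * pi * (x - y)\<^sup>2 / t) - pi * t * (x\<^sup>2 + y\<^sup>2) / 4) / (2 * sqrt t)
      - exp (- (t * (x\<^sup>2 + y\<^sup>2) / 4)) \<le> heat t x y"
  proof -
    have "2 * pi * \<rho> * (x - y)\<^sup>2 / (1 - \<rho>\<^sup>2) \<le> 2 * pi * 1 * (x - y)\<^sup>2 / (t / 4)"
      using b t by (intro frac_le mult_mono) auto
    moreover have "pi * ((1 - \<rho>) / (1 + \<rho>)) * (x\<^sup>2 + y\<^sup>2) \<le> pi * (t / 4) * (x\<^sup>2 + y\<^sup>2)"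
      using b by (intro mult_right_mono mult_left_mono) auto
    ultimately have "exp (- (8 * pi * (x - y)\<^sup>2 / t) - pi * t * (x\<^sup>2 + y\<^sup>2) / 4) \<le> G x y (x - y)"
      unfolding G_def by simp
    hence "1 / (2 * sqrt t) * exp (- (8 * pi * (x - y)\<^sup>2 / t) - pi * t * (x\<^sup>2 + y\<^sup>2) / 4) \<le> A * G x y (x - y)"
      using A2 A0 st by (intro mult_mono) auto
    moreover have "A * G x y (x + y) \<ge> 0" using A0 by (simp add: G_def)
    ultimately show ?thesis using heat[of x y] H[of x y] by (simp add: distrib_left)
  qed
  show "heat t x x \<le> 3 / sqrt t * exp (- (t * x\<^sup>2 / 4))"
  proof -
    define e where "e = exp (- (t * x\<^sup>2 / 4))"
    have G: "G x x z \<le> e" for z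
    proof -
      have "t / 8 \<le> 3 * (t / 16)" using t by simp
      also have "\<dots> \<le> pi * ((1 - \<rho>) / (1 + \<rho>))" using b t pi by (intro mult_mono) auto
      finally have "t / 8 * (x\<^sup>2 + x\<^sup>2) \<le> pi * ((1 - \<rho>) / (1 + \<rho>)) * (x\<^sup>2 + x\<^sup>2)"
        by (rule mult_right_mono) simp
      moreover have "0 \<le> 2 * pi * \<rho> * z\<^sup>2 / (1 - \<rho>\<^sup>2)" using b t by (intro divide_nonneg_nonneg) auto
      ultimately show ?thesis unfolding G_def e_def by simp
    qed
    have "A * (G x x (x - x) + G x x (x + x)) \<le> sqrt 2 / (2 * sqrt t) * (e + e)"
      by (intro mult_mono[OF A1] add_mono G) (use st in \<open>auto simp: G_def intro!: add_nonneg_nonneg\<close>)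
    also have "\<dots> = sqrt 2 / sqrt t * e" using st by simp
    also have "\<dots> \<le> 2 / sqrt t * e"
      using st sqrt2_less_2 by (intro mult_right_mono divide_right_mono) (auto simp: e_def)
    finally have 1: "A * (G x x (x - x) + G x x (x + x)) \<le> 2 / sqrt t * e" .
    have "H x x \<le> exp (- (t * (x\<^sup>2 + x\<^sup>2) / 4))" by (rule H)
    also have "\<dots> \<le> e" unfolding e_def using t by simp
    also have "e = 1 * e" by simp
    also have "\<dots> \<le> 1 / sqrt t * e"
      using t st by (intro mult_right_mono) (auto simp: e_def le_divide_eq)
    finally have 2: "H x x \<le> 1 / sqrt t * e" .
    have "heat t x x \<le> 2 / sqrt t * e + 1 / sqrt t * e" using heat[of x x] 1 2 by simp
    also have "\<dots> = 3 / sqrt t * e" by (simp add: distrib_right[symmetric] add_divide_distrib[symmetric])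
    finally show ?thesis unfolding e_def .
  qed
qed

section \<open>The reproducing kernel as a time integral\<close>

text \<open>The density \<open>1 / (\<surd>t log(1/t)\<^bsup>1+\<eta>\<^esup>)\<close> of the moment measure times the height \<open>1 / \<surd>t\<close> of the
  kernel at time \<open>t\<close>.\<close>

definition log_density :: "real \<Rightarrow> real \<Rightarrow> real" where
  "log_density \<eta> t = 1 / (t * ln (1 / t) powr (1 + \<eta>))"

lemma two_le_ln_inverse:
  assumes "0 < t" "t < exp (- 2 :: real)" shows "2 < ln (1 / t)"
proof -
  have "ln t < ln (exp (- 2))" using assms by (subst ln_less_cancel_iff) auto
  thus ?thesis using assms by (simp add: ln_div)
qed

lemma log_density_integral:
  fixes \<eta> a :: real
  assumes \<eta>: "0 < \<eta>" and a: "0 < a" "a \<le> exp (- 2)"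
  shows "set_integrable lborel {0<..<a} (log_density \<eta>)"
    and "(LBINT t:{0<..<a}. log_density \<eta> t) = ln (1 / a) powr (- \<eta>) / \<eta>"
proof -
  let ?F = "\<lambda>t::real. ln (1 / t) powr (- \<eta>) / \<eta>"
  have ei: "einterval (ereal 0) (ereal a) = {0<..<a}" by (auto simp: einterval_def)
  have pos: "2 < ln (1 / t)" if "0 < t" "t < a" for t
    using two_le_ln_inverse[of t] that a by simp
  have a1: "a < 1" using a(2) by (rule le_less_trans) simp
  have ln_a: "2 \<le> ln (1 / a)"
  proof -
    have "ln a \<le> ln (exp (- 2))" using a by (subst ln_le_cancel_iff) auto
    thus ?thesis using a by (simp add: ln_div)
  qed
  have d: "(?F has_real_derivative log_density \<eta> t) (at t)" if "0 < t" "t < a" for t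
  proof -
    have "(?F has_real_derivative (- \<eta> * ln (1 / t) powr (- \<eta> - 1) * (- 1 / t)) / \<eta>) (at t)"
      using that pos[OF that] a1 by (auto intro!: derivative_eq_intros simp: power2_eq_square)
    moreover have "(- \<eta> * ln (1 / t) powr (- \<eta> - 1) * (- 1 / t)) / \<eta> = log_density \<eta> t"
    proof -
      have "- \<eta> - 1 = - (1 + \<eta>)" by simp
      thus ?thesis using \<eta> by (simp only: powr_minus) (simp add: log_density_def divide_inverse mult_ac)
    qed
    ultimately show ?thesis by simp
  qed
  have c: "isCont (log_density \<eta>) t" if "0 < t" "t < a" for t
    unfolding log_density_def[abs_def] using that pos[OF that]
    by (intro continuous_intros) auto
  have nn: "AE t in lborel. ereal 0 < ereal t \<longrightarrow> ereal t < ereal a \<longrightarrow> 0 \<le> log_density \<eta> t"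
    by (simp add: log_density_def)
  have A: "((?F \<circ> real_of_ereal) \<longlongrightarrow> 0) (at_right (ereal 0))"
    unfolding o_def at_right_ereal filterlim_filtermap real_of_ereal.simps
    using \<eta> by real_asymp
  have "isCont ?F a" using a ln_a \<eta> by (intro continuous_intros) auto
  hence B: "((?F \<circ> real_of_ereal) \<longlongrightarrow> ?F a) (at_left (ereal a))"
    unfolding o_def at_left_ereal filterlim_filtermap real_of_ereal.simps
    by (metis isCont_def filterlim_at_split)
  note ftc = interval_integral_FTC_nonneg[of "ereal 0" "ereal a" ?F "log_density \<eta>" 0 "?F a"]
  show "set_integrable lborel {0<..<a} (log_density \<eta>)"
    unfolding ei[symmetric] by (rule ftc(1)) (use a d c nn A B in auto)
  have "(LBINT t=ereal 0..ereal a. log_density \<eta> t) = ?F a - 0"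
    by (rule ftc(2)) (use a d c nn A B in auto)
  thus "(LBINT t:{0<..<a}. log_density \<eta> t) = ?F a"
    using a by (simp add: interval_lebesgue_integral_def ei)
qed

abbreviation time_interval :: "real set" where "time_interval \<equiv> {0<..<exp (- 2)}"

lemma log_density_integral_full:
  assumes "0 < \<eta>"
  shows "set_integrable lborel time_interval (log_density \<eta>)"
    and "(LBINT t:time_interval. log_density \<eta> t) = 2 powr (- \<eta>) / \<eta>"
proof -
  have "ln (1 / exp (- 2)) = (2::real)" by (simp add: ln_div)
  with log_density_integral[OF assms, of "exp (- 2)"]
  show "set_integrable lborel time_interval (log_density \<eta>)"
    and "(LBINT t:time_interval. log_density \<eta> t) = 2 powr (- \<eta>) / \<eta>"
    by simp_all
qed

definition kernel_integrand :: "real \<Rightarrow> real \<Rightarrow> real \<Rightarrow> real \<Rightarrow> real" where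
  "kernel_integrand \<eta> x y t = exp (- t) * heat t x y * (sqrt t * log_density \<eta> t)"

lemma sqrt_log_density:
  assumes "t > 0" shows "sqrt t * log_density \<eta> t = 1 / (sqrt t * ln (1 / t) powr (1 + \<eta>))"
  using assms by (simp add: log_density_def divide_simps)

lemma time_interval_less_1: "t \<in> time_interval \<Longrightarrow> 0 < t \<and> t < 1"
  by (auto intro: less_trans)

lemma heat_measurable [measurable]: "(\<lambda>t. heat t x y) \<in> borel_measurable borel"
  unfolding heat_def by measurable

lemma log_density_measurable [measurable]: "log_density \<eta> \<in> borel_measurable borel"
  unfolding log_density_def[abs_def] by measurable

lemma weight_integrable:
  assumes \<eta>: "0 < \<eta>"
  shows "set_integrable lborel time_interval
      (\<lambda>t. exp (- (real j + 1) * t) / (sqrt t * ln (1 / t) powr (1 + \<eta>)))"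
    and "weight \<eta> j \<le> 2 powr (- \<eta>) / \<eta>"
proof -
  let ?h = "\<lambda>t. exp (- (real j + 1) * t) / (sqrt t * ln (1 / t) powr (1 + \<eta>))"
  have le: "0 \<le> ?h t \<and> ?h t \<le> log_density \<eta> t" if "t \<in> time_interval" for t
  proof -
    have t: "0 < t" "t \<le> 1" using time_interval_less_1[OF that] by auto
    have ld: "log_density \<eta> t \<ge> 0" using t by (simp add: log_density_def)
    have "?h t = exp (- (real j + 1) * t) * (sqrt t * log_density \<eta> t)"
      unfolding sqrt_log_density[OF t(1)] by simp
    moreover have "exp (- (real j + 1) * t) * (sqrt t * log_density \<eta> t) \<le> 1 * (1 * log_density \<eta> t)"
      using t ld by (intro mult_mono) (auto intro!: mult_nonpos_nonneg)
    ultimately show ?thesis using t ld by auto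
  qed
  have "integrable lborel (\<lambda>t. indicator time_interval t *\<^sub>R ?h t)"
  proof (rule Bochner_Integration.integrable_bound)
    show "integrable lborel (\<lambda>t. indicator time_interval t *\<^sub>R log_density \<eta> t)"
      using log_density_integral_full(1)[OF \<eta>] unfolding set_integrable_def .
    show "AE t in lborel. norm (indicator time_interval t *\<^sub>R ?h t)
        \<le> norm (indicator time_interval t *\<^sub>R log_density \<eta> t)"
    proof (rule AE_I2)
      fix t
      show "norm (indicator time_interval t *\<^sub>R ?h t) \<le> norm (indicator time_interval t *\<^sub>R log_density \<eta> t)"
      proof (cases "t \<in> time_interval")
        case True
        have "\<bar>?h t\<bar> \<le> \<bar>log_density \<eta> t\<bar>" using le[OF True] by linarith
        thus ?thesis using True by (simp only: indicator_simps scaleR_one real_norm_def)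
      qed simp
    qed
  qed measurable
  thus i: "set_integrable lborel time_interval ?h" unfolding set_integrable_def .
  have "weight \<eta> j \<le> (LBINT t:time_interval. log_density \<eta> t)"
    unfolding weight_def by (rule set_integral_mono[OF i log_density_integral_full(1)[OF \<eta>]]) (use le in auto)
  thus "weight \<eta> j \<le> 2 powr (- \<eta>) / \<eta>" unfolding log_density_integral_full(2)[OF \<eta>] .
qed

lemma weight_pos:
  assumes \<eta>: "0 < \<eta>"
  shows "weight \<eta> j > 0"
proof -
  let ?f = "\<lambda>t. indicator time_interval t *\<^sub>R (exp (- (real j + 1) * t) / (sqrt t * ln (1 / t) powr (1 + \<eta>)))"
  have int: "integrable lborel ?f"
    using weight_integrable(1)[OF \<eta>, of j] unfolding set_integrable_def .
  have nn: "?f t \<ge> 0" for t by (cases "t \<in> time_interval") auto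
  have w: "weight \<eta> j = integral\<^sup>L lborel ?f"
    unfolding weight_def set_lebesgue_integral_def ..
  have "weight \<eta> j \<noteq> 0"
  proof
    assume "weight \<eta> j = 0"
    hence "AE t in lborel. ?f t = 0"
      unfolding w using integral_nonneg_eq_0_iff_AE[OF int] nn by simp
    hence "AE t in lborel. t \<notin> time_interval"
    proof eventually_elim
      case (elim t)
      show ?case
      proof
        assume t: "t \<in> time_interval"
        hence "2 < ln (1 / t)" using two_le_ln_inverse by simp
        thus False using elim t by simp
      qed
    qed
    hence "emeasure lborel time_interval = 0"
      using AE_iff_null_sets[of time_interval lborel] by auto
    thus False by (simp add: emeasure_lborel_Ioo)
  qed
  moreover have "weight \<eta> j \<ge> 0" unfolding w by (rule Bochner_Integration.integral_nonneg) (rule nn)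
  ultimately show ?thesis by simp
qed

lemma heat_diag_le: "0 < t \<Longrightarrow> t \<le> 1 \<Longrightarrow> heat t x x \<le> 3 / sqrt t"
proof -
  assume t: "0 < t" "t \<le> 1"
  have "3 / sqrt t * exp (- (t * x\<^sup>2 / 4)) \<le> 3 / sqrt t * 1"
    using t by (intro mult_left_mono) auto
  thus ?thesis using heat_upper[OF t, of x] by simp
qed

text \<open>By the inequality between the arithmetic and geometric mean, off-diagonal partial sums are
  controlled by the diagonal ones, whose terms are nonnegative.\<close>

lemma heat_partial_sum_le:
  assumes t: "0 < t" "t \<le> 1"
  shows "\<bar>\<Sum>j<N. exp (- (real j * t)) * (hermite_fun (4 * j) x * hermite_fun (4 * j) y)\<bar> \<le> 3 / sqrt t"
proof -
  let ?e = "\<lambda>j. exp (- (real j * t))"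
  have diag: "(\<Sum>j<N. ?e j * (hermite_fun (4 * j) x * hermite_fun (4 * j) x)) \<le> 3 / sqrt t" for x
  proof -
    have "(\<Sum>j<N. ?e j * (hermite_fun (4 * j) x * hermite_fun (4 * j) x)) \<le> heat t x x"
      unfolding heat_def using heat_formula(1)[OF t(1), of x x]
      by (intro sum_le_suminf) (auto simp: sums_iff)
    thus ?thesis using heat_diag_le[OF t, of x] by simp
  qed
  have am: "\<bar>u * v\<bar> \<le> (u * u + v * v) / 2" for u v :: real
    using sum_squares_bound[of "\<bar>u\<bar>" "\<bar>v\<bar>"] by (simp add: abs_mult power2_eq_square)
  have "\<bar>\<Sum>j<N. ?e j * (hermite_fun (4 * j) x * hermite_fun (4 * j) y)\<bar> \<le>
      (\<Sum>j<N. ?e j * \<bar>hermite_fun (4 * j) x * hermite_fun (4 * j) y\<bar>)"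
    by (rule order_trans[OF sum_abs]) (simp add: abs_mult)
  also have "\<dots> \<le> (\<Sum>j<N. ?e j * ((hermite_fun (4 * j) x * hermite_fun (4 * j) x
      + hermite_fun (4 * j) y * hermite_fun (4 * j) y) / 2))"
    by (intro sum_mono mult_left_mono am) auto
  also have "\<dots> = ((\<Sum>j<N. ?e j * (hermite_fun (4 * j) x * hermite_fun (4 * j) x))
      + (\<Sum>j<N. ?e j * (hermite_fun (4 * j) y * hermite_fun (4 * j) y))) / 2"
    by (simp add: sum.distrib[symmetric] sum_divide_distrib distrib_left)
  also have "\<dots> \<le> 3 / sqrt t" using diag[of x] diag[of y] by simp
  finally show ?thesis .
qed

text \<open>Sum and integral are exchanged by dominated convergence; by \<open>heat_partial_sum_le\<close> the partial sums
  are dominated by \<open>3 log_density\<close>.\<close>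

lemma kernel_as_integral:
  assumes \<eta>: "0 < \<eta>"
  shows "set_integrable lborel time_interval (kernel_integrand \<eta> x y)"
    and "(\<lambda>j. weight \<eta> j * hermite_fun (4 * j) x * hermite_fun (4 * j) y) sums
      (LBINT t:time_interval. kernel_integrand \<eta> x y t)"
proof -
  let ?p = "\<lambda>j. hermite_fun (4 * j) x * hermite_fun (4 * j) y"
  let ?I = "indicator time_interval :: real \<Rightarrow> real"
  define s where "s N t = ?I t * (exp (- t) * (\<Sum>j<N. exp (- (real j * t)) * ?p j) * (sqrt t * log_density \<eta> t))" for N t
  define f where "f t = ?I t * kernel_integrand \<eta> x y t" for t
  define g where "g t = 3 * (?I t * log_density \<eta> t)" for t
  have gi: "integrable lborel g"
    using log_density_integral_full(1)[OF \<eta>] unfolding g_def set_integrable_def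
    by (intro integrable_mult_right) simp
  have sm: "s N \<in> borel_measurable lborel" for N unfolding s_def[abs_def] by measurable
  have fm: "f \<in> borel_measurable lborel" unfolding f_def[abs_def] kernel_integrand_def by measurable
  have lim: "(\<lambda>N. s N t) \<longlonglongrightarrow> f t" for t
  proof (cases "t \<in> time_interval")
    case True
    hence "t > 0" by simp
    from heat_formula(1)[OF this, of x y]
    have "(\<lambda>N. \<Sum>j<N. exp (- (real j * t)) * ?p j) \<longlonglongrightarrow> heat t x y" by (simp add: sums_def)
    thus ?thesis unfolding s_def f_def kernel_integrand_def by (intro tendsto_intros)
  qed (simp add: s_def f_def)
  have bound: "norm (s N t) \<le> g t" for N t
  proof (cases "t \<in> time_interval")
    case True
    hence t: "0 < t" "t \<le> 1" using time_interval_less_1 by force+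
    have ld: "log_density \<eta> t \<ge> 0" using t by (simp add: log_density_def)
    have "norm (s N t) = exp (- t) * \<bar>\<Sum>j<N. exp (- (real j * t)) * ?p j\<bar> * (sqrt t * log_density \<eta> t)"
      unfolding s_def using True t ld by (simp add: abs_mult)
    also have "\<dots> \<le> 1 * (3 / sqrt t) * (sqrt t * log_density \<eta> t)"
      using t ld by (intro mult_right_mono mult_mono heat_partial_sum_le) auto
    also have "\<dots> = g t" using True t by (simp add: g_def)
    finally show ?thesis .
  qed (simp add: s_def g_def)
  have fi: "integrable lborel f"
    by (rule integrable_dominated_convergence[where s = s and w = g]) (use fm sm gi lim bound in auto)
  have conv: "(\<lambda>N. integral\<^sup>L lborel (s N)) \<longlonglongrightarrow> integral\<^sup>L lborel f"
    by (rule integral_dominated_convergence[where w = g]) (use fm sm gi lim bound in auto)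
  show "set_integrable lborel time_interval (kernel_integrand \<eta> x y)"
    using fi unfolding f_def[abs_def] set_integrable_def by simp
  define h where "h j t = ?I t * (exp (- (real j + 1) * t) / (sqrt t * ln (1 / t) powr (1 + \<eta>)))" for j t
  have hi: "integrable lborel (h j)" for j
    using weight_integrable(1)[OF \<eta>, of j] unfolding h_def[abs_def] set_integrable_def by simp
  have w: "weight \<eta> j = integral\<^sup>L lborel (h j)" for j
    unfolding weight_def set_lebesgue_integral_def h_def by simp
  have "integral\<^sup>L lborel (s N) = (\<Sum>j<N. weight \<eta> j * ?p j)" for N
  proof -
    have "s N t = (\<Sum>j<N. h j t * ?p j)" for t
    proof (cases "t \<in> time_interval")
      case True
      hence t: "t > 0" by simp
      have e: "exp (- t) * exp (- (real j * t)) = exp (- (real j + 1) * t)" for j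
        by (simp add: exp_add[symmetric] algebra_simps)
      have "s N t = (\<Sum>j<N. (exp (- t) * exp (- (real j * t))) * (1 / (sqrt t * ln (1 / t) powr (1 + \<eta>))) * ?p j)"
        unfolding s_def sqrt_log_density[OF t] using True
        by (simp add: sum_distrib_left sum_distrib_right mult_ac)
      also have "\<dots> = (\<Sum>j<N. h j t * ?p j)" unfolding e h_def using True by simp
      finally show ?thesis .
    qed (simp add: s_def h_def)
    hence "integral\<^sup>L lborel (s N) = (LBINT t. (\<Sum>j<N. h j t * ?p j))" by presburger
    also have "\<dots> = (\<Sum>j<N. weight \<eta> j * ?p j)"
      by (subst Bochner_Integration.integral_sum) (use hi in \<open>auto simp: w\<close>)
    finally show ?thesis .
  qed
  with conv have "(\<lambda>N. \<Sum>j<N. weight \<eta> j * ?p j) \<longlonglongrightarrow> integral\<^sup>L lborel f" by simp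
  moreover have "integral\<^sup>L lborel f = (LBINT t:time_interval. kernel_integrand \<eta> x y t)"
    unfolding f_def set_lebesgue_integral_def by simp
  ultimately show "(\<lambda>j. weight \<eta> j * hermite_fun (4 * j) x * hermite_fun (4 * j) y) sums
      (LBINT t:time_interval. kernel_integrand \<eta> x y t)"
    unfolding sums_def by (simp add: mult.assoc)
qed

lemma kernel_eq_integral:
  "0 < \<eta> \<Longrightarrow> kernel \<eta> x y = (LBINT t:time_interval. kernel_integrand \<eta> x y t)"
  unfolding kernel_def using kernel_as_integral(2) by (rule sums_unique[symmetric])

lemma log_density_nonneg: "0 < t \<Longrightarrow> log_density \<eta> t \<ge> 0"
  by (simp add: log_density_def)

lemma kernel_le:
  assumes \<eta>: "0 < \<eta>"
  shows "kernel \<eta> x x \<le> 3 * 2 powr (- \<eta>) / \<eta>"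
proof -
  have "kernel \<eta> x x \<le> (LBINT t:time_interval. 3 * log_density \<eta> t)"
    unfolding kernel_eq_integral[OF \<eta>]
  proof (rule set_integral_mono)
    show "set_integrable lborel time_interval (\<lambda>t. 3 * log_density \<eta> t)"
      using log_density_integral_full(1)[OF \<eta>] by simp
    fix t :: real assume "t \<in> time_interval"
    hence t: "0 < t" "t \<le> 1" using time_interval_less_1 by force+
    have "kernel_integrand \<eta> x x t \<le> 1 * (3 / sqrt t) * (sqrt t * log_density \<eta> t)"
      unfolding kernel_integrand_def
      using heat_diag_le[OF t, of x] t log_density_nonneg[OF t(1), of \<eta>]
      by (intro mult_right_mono order_trans[OF mult_left_mono[of "heat t x x" "3 / sqrt t"]] mult_mono) auto
    thus "kernel_integrand \<eta> x x t \<le> 3 * log_density \<eta> t" using t by simp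
  qed (rule kernel_as_integral(1)[OF \<eta>])
  also have "\<dots> = 3 * (2 powr (- \<eta>) / \<eta>)"
    using log_density_integral_full(2)[OF \<eta>] by simp
  finally show ?thesis by simp
qed

text \<open>The time integral is split at \<open>t = 1/x\<close>: before that the logarithmic density integrates to
  \<open>(log x)\<^bsup>-\<eta>\<^esup> / \<eta>\<close>, afterwards the damping is at least \<open>exp(-x/4)\<close>. Splitting at \<open>1/x\<^sup>2\<close>, where the
  damping really sets in, would only change the constant.\<close>

lemma kernel_decay:
  assumes \<eta>: "0 < \<eta>"
  shows "\<exists>X. \<forall>x\<ge>X. kernel \<eta> x x \<le> 4 / \<eta> * ln x powr (- \<eta>)"
proof -
  have "eventually (\<lambda>x::real. 3 * exp (- (x / 4)) * 2 powr (- \<eta>) \<le> ln x powr (- \<eta>)) at_top"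
    using \<eta> by real_asymp
  then obtain X0 where X0: "\<And>x::real. x \<ge> X0 \<Longrightarrow> 3 * exp (- (x / 4)) * 2 powr (- \<eta>) \<le> ln x powr (- \<eta>)"
    by (auto simp: eventually_at_top_linorder)
  show ?thesis
  proof (intro exI allI impI)
    fix x :: real assume x: "x \<ge> max X0 (exp 2)"
    hence x0: "x > 0" by (metis exp_gt_zero less_le_trans max.bounded_iff)
    have a: "0 < 1 / x" "1 / x \<le> exp (- 2)" using x x0 by (simp_all add: exp_minus field_simps)
    note Lx = log_density_integral[OF \<eta> a]
    note L2 = log_density_integral_full[OF \<eta>]
    have ix: "set_integrable lborel time_interval (\<lambda>t. indicator {0<..<1/x} t * log_density \<eta> t)"
    proof -
      have "(\<lambda>t. indicator time_interval t *\<^sub>R (indicator {0<..<1/x} t * log_density \<eta> t)) =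
          (\<lambda>t. indicator {0<..<1/x} t *\<^sub>R log_density \<eta> t)"
        using a by (auto simp: indicator_def fun_eq_iff)
      thus ?thesis using Lx(1) unfolding set_integrable_def by simp
    qed
    have "kernel \<eta> x x \<le> (LBINT t:time_interval. 3 * (indicator {0<..<1/x} t * log_density \<eta> t)
        + 3 * exp (- (x / 4)) * log_density \<eta> t)"
      unfolding kernel_eq_integral[OF \<eta>]
    proof (rule set_integral_mono)
      show "set_integrable lborel time_interval (\<lambda>t. 3 * (indicator {0<..<1/x} t * log_density \<eta> t)
        + 3 * exp (- (x / 4)) * log_density \<eta> t)"
        using L2(1) ix by (intro set_integral_add set_integrable_mult_right) auto
      fix t :: real assume "t \<in> time_interval"
      hence t: "0 < t" "t \<le> 1" using time_interval_less_1 by force+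
      have ld: "log_density \<eta> t \<ge> 0" by (rule log_density_nonneg[OF t(1)])
      have "exp (- t) * heat t x x \<le> 1 * (3 / sqrt t * exp (- (t * x\<^sup>2 / 4)))"
        using heat_upper[OF t, of x] t by (intro order_trans[OF mult_left_mono mult_right_mono]) auto
      hence "kernel_integrand \<eta> x x t \<le> (3 / sqrt t * exp (- (t * x\<^sup>2 / 4))) * (sqrt t * log_density \<eta> t)"
        unfolding kernel_integrand_def using t ld by (intro mult_right_mono) auto
      also have "\<dots> = 3 * exp (- (t * x\<^sup>2 / 4)) * log_density \<eta> t" using t by simp
      also have "\<dots> \<le> 3 * (indicator {0<..<1/x} t + exp (- (x / 4))) * log_density \<eta> t"
      proof (intro mult_right_mono mult_left_mono ld)
        show "exp (- (t * x\<^sup>2 / 4)) \<le> indicator {0<..<1/x} t + exp (- (x / 4))"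
        proof (cases "t < 1 / x")
          case True
          have "exp (- (t * x\<^sup>2 / 4)) \<le> 1" using t by simp
          thus ?thesis using True t by (simp add: add_increasing2)
        next
          case False
          hence "1 \<le> t * x" using x0 by (simp add: field_simps)
          hence "1 * x \<le> t * x * x" using x0 by (intro mult_right_mono) auto
          thus ?thesis using False by (simp add: power2_eq_square mult.assoc)
        qed
      qed simp
      finally show "kernel_integrand \<eta> x x t \<le> 3 * (indicator {0<..<1/x} t * log_density \<eta> t)
        + 3 * exp (- (x / 4)) * log_density \<eta> t" by (simp add: algebra_simps)
    qed (rule kernel_as_integral(1)[OF \<eta>])
    also have "\<dots> = 3 * (LBINT t:time_interval. indicator {0<..<1/x} t * log_density \<eta> t)
        + 3 * exp (- (x / 4)) * (LBINT t:time_interval. log_density \<eta> t)"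
      using L2(1) ix by (simp add: set_integral_add(2))
    also have "(LBINT t:time_interval. indicator {0<..<1/x} t * log_density \<eta> t) =
        (LBINT t:{0<..<1/x}. log_density \<eta> t)"
      unfolding set_lebesgue_integral_def using a by (intro Bochner_Integration.integral_cong) (auto simp: indicator_def)
    also have "3 * (LBINT t:{0<..<1/x}. log_density \<eta> t) + 3 * exp (- (x / 4)) * (LBINT t:time_interval. log_density \<eta> t)
       = (3 * ln x powr (- \<eta>) + 3 * exp (- (x / 4)) * 2 powr (- \<eta>)) / \<eta>"
      using Lx(2) L2(2) by (simp add: exp_minus add_divide_distrib)
    also have "\<dots> \<le> (3 * ln x powr (- \<eta>) + ln x powr (- \<eta>)) / \<eta>"
      using X0[of x] x \<eta> by (intro divide_right_mono add_left_mono) auto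
    finally show "kernel \<eta> x x \<le> 4 / \<eta> * ln x powr (- \<eta>)" by simp
  qed
qed

text \<open>On the time window \<open>[1/R\<^sup>2, 2/R\<^sup>2]\<close> both exponents in \<open>heat_bounds\<close> are bounded: the distance of the
  points is at most \<open>2/R\<close>, and \<open>t (x\<^sup>2 + y\<^sup>2) \<le> 16\<close>, which
  bounds them by \<open>32 \<pi>\<close> and \<open>4 \<pi>\<close>. The error is weakened to \<open>8 / (R \<surd>t)\<close>, by
  \<open>\<surd>u exp(-u/8) \<le> 8\<close>, in order that it integrates against \<open>log_density\<close>.\<close>

lemma heat_lower_near:
  fixes R x y t :: real
  assumes R: "2 \<le> R" and x: "\<bar>x - R\<bar> \<le> 1 / R" and y: "\<bar>y - R\<bar> \<le> 1 / R" and t: "0 < t" "t \<le> 1"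
  shows "indicator {1 / R\<^sup>2..2 / R\<^sup>2} t * (exp (- (36 * pi)) / (2 * sqrt t)) - 8 / (R * sqrt t) \<le> heat t x y"
proof -
  have R1: "1 / R \<le> 1 / 2" "1 / R > 0" using R by (simp_all add: field_simps)
  have xb: "R / 2 \<le> x" "x \<le> 3 / 2 * R" "R / 2 \<le> y" "y \<le> 3 / 2 * R"
    using abs_le_D1[OF x] abs_le_D2[OF x] abs_le_D1[OF y] abs_le_D2[OF y] R R1 by linarith+
  have sq: "(R / 2)\<^sup>2 \<le> x\<^sup>2" "(R / 2)\<^sup>2 \<le> y\<^sup>2" "x\<^sup>2 \<le> (3 / 2 * R)\<^sup>2" "y\<^sup>2 \<le> (3 / 2 * R)\<^sup>2"
    using xb R by (auto intro!: power_mono)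
  have low: "R\<^sup>2 / 2 \<le> x\<^sup>2 + y\<^sup>2" and up: "x\<^sup>2 + y\<^sup>2 \<le> 8 * R\<^sup>2"
    using sq by (auto simp: power_mult_distrib power_divide)
  have "exp (- (t * (x\<^sup>2 + y\<^sup>2) / 4)) \<le> 8 / (R * sqrt t)"
  proof -
    define u where "u = t * R\<^sup>2"
    have u: "u > 0" using t R by (simp add: u_def)
    have su: "sqrt u = R * sqrt t" using R by (simp add: u_def real_sqrt_mult)
    have "sqrt u \<le> 8 + u"
    proof -
      have "sqrt u * 1 \<le> (sqrt u * sqrt u + 1 * 1) / 2"
        using sum_squares_bound[of "sqrt u" 1] by (simp add: power2_eq_square)
      thus ?thesis using u by simp
    qed
    also have "8 + u \<le> 8 * exp (u / 8)" using exp_ge_add_one_self[of "u / 8"] by linarith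
    finally have "exp (- (u / 8)) \<le> 8 / sqrt u" using u by (simp add: exp_minus field_simps)
    moreover have "exp (- (t * (x\<^sup>2 + y\<^sup>2) / 4)) \<le> exp (- (u / 8))"
      using mult_left_mono[OF low, of t] t by (simp add: u_def)
    ultimately show ?thesis unfolding su by (rule order_trans[rotated])
  qed
  moreover have "indicator {1 / R\<^sup>2..2 / R\<^sup>2} t * (exp (- (36 * pi)) / (2 * sqrt t)) \<le>
     exp (- (8 * pi * (x - y)\<^sup>2 / t) - pi * t * (x\<^sup>2 + y\<^sup>2) / 4) / (2 * sqrt t)"
  proof (cases "t \<in> {1 / R\<^sup>2..2 / R\<^sup>2}")
    case True
    have "\<bar>x - y\<bar> \<le> 2 / R" using x y by (simp add: abs_le_iff)
    hence "(x - y)\<^sup>2 \<le> (2 / R)\<^sup>2" using power_mono[of "\<bar>x - y\<bar>" "2 / R" 2] by simp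
    also have "\<dots> = 4 * (1 / R\<^sup>2)" by (simp add: power_divide)
    also have "\<dots> \<le> 4 * t" using True by simp
    finally have "(x - y)\<^sup>2 / t \<le> 4" using t by (simp add: field_simps)
    hence 1: "8 * pi * ((x - y)\<^sup>2 / t) \<le> 8 * pi * 4" by (intro mult_left_mono) auto
    have "t * (x\<^sup>2 + y\<^sup>2) \<le> 2 / R\<^sup>2 * (8 * R\<^sup>2)" using up True t by (intro mult_mono) auto
    hence "t * (x\<^sup>2 + y\<^sup>2) \<le> 16" using R by simp
    hence 2: "pi / 4 * (t * (x\<^sup>2 + y\<^sup>2)) \<le> pi / 4 * 16" by (intro mult_left_mono) auto
    have "- (36 * pi) \<le> - (8 * pi * (x - y)\<^sup>2 / t) - pi * t * (x\<^sup>2 + y\<^sup>2) / 4"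
    proof -
      have "8 * pi * (x - y)\<^sup>2 / t = 8 * pi * ((x - y)\<^sup>2 / t)"
        "pi * t * (x\<^sup>2 + y\<^sup>2) / 4 = pi / 4 * (t * (x\<^sup>2 + y\<^sup>2))" by simp_all
      thus ?thesis using 1 2 by linarith
    qed
    thus ?thesis using True t by (simp add: divide_right_mono)
  qed (use t in simp)
  ultimately show ?thesis using heat_lower[OF t, of x y] by linarith
qed

text \<open>The window has length \<open>1/R\<^sup>2\<close>, and there \<open>log_density\<close> is at least
  \<open>(R\<^sup>2/2) (2 log R)\<^bsup>-1-\<eta>\<^esup>\<close>. The error term, of order \<open>1/R\<close>, is eventually less than half of what the window contributes.\<close>

lemma kernel_lower_near:
  assumes \<eta>: "0 < \<eta>"
  shows "\<exists>c>0. \<exists>R0. \<forall>R\<ge>R0. \<forall>x y. \<bar>x - R\<bar> \<le> 1 / R \<longrightarrow> \<bar>y - R\<bar> \<le> 1 / R \<longrightarrow>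
    c * ln R powr (- 1 - \<eta>) \<le> kernel \<eta> x y"
proof -
  define K where "K = exp (- (36 * pi)) * exp (- 1) / 4 * 2 powr (- 1 - \<eta>)"
  have K: "K > 0" by (simp add: K_def)
  define D where "D = 8 * 2 powr (- \<eta>) / \<eta>"
  have "eventually (\<lambda>R::real. D / R \<le> K / 2 * ln R powr (- 1 - \<eta>)) at_top"
    using \<eta> K by real_asymp
  then obtain R1 where R1: "\<And>R::real. R \<ge> R1 \<Longrightarrow> D / R \<le> K / 2 * ln R powr (- 1 - \<eta>)"
    by (auto simp: eventually_at_top_linorder)
  show ?thesis
  proof (rule exI[of _ "K / 2"], intro conjI exI[of _ "max R1 (exp 2)"] allI impI)
    fix R x y :: real
    assume R: "R \<ge> max R1 (exp 2)" and x: "\<bar>x - R\<bar> \<le> 1 / R" and y: "\<bar>y - R\<bar> \<le> 1 / R"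
    have e2: "exp 2 \<ge> (3::real)" using exp_ge_add_one_self[of "2::real"] by simp
    have Rb: "R \<ge> 3" "R \<ge> exp 2" using R e2 by auto
    have lnR: "ln R \<ge> 2" using Rb(2) by (metis exp_gt_zero ln_exp ln_le_cancel_iff less_le_trans)
    define k where "k = exp (- (36 * pi)) * exp (- 1) / 2 * (R\<^sup>2 / 2 * (2 * ln R) powr (- 1 - \<eta>))"
    have k: "k \<ge> 0" by (simp add: k_def)
    let ?J = "{1 / R\<^sup>2..2 / R\<^sup>2}"
    have J: "?J \<subseteq> time_interval"
    proof -
      have "2 * exp 2 < R * R"
        using Rb mult_mono[of "exp 2" R 3 R] exp_gt_zero[of "2::real"] by linarith
      hence "2 / R\<^sup>2 < exp (- 2)" using Rb by (simp add: exp_minus field_simps power2_eq_square)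
      moreover have "1 / R\<^sup>2 > 0" using Rb by simp
      ultimately show ?thesis unfolding subset_iff atLeastAtMost_iff greaterThanLessThan_iff by linarith
    qed
    have iJ: "set_integrable lborel time_interval (\<lambda>t. k * indicator ?J t)"
    proof -
      have "(\<lambda>t. indicator time_interval t *\<^sub>R (k * indicator ?J t)) = (\<lambda>t. k * indicator ?J t)"
        using J by (auto simp: indicator_def fun_eq_iff)
      moreover have "integrable lborel (indicator ?J :: real \<Rightarrow> real)"
        by (intro integrable_real_indicator) (auto simp: emeasure_lborel_Icc_eq)
      ultimately show ?thesis unfolding set_integrable_def by simp
    qed
    note L2 = log_density_integral_full[OF \<eta>]
    have "(LBINT t:time_interval. k * indicator ?J t - 8 / R * log_density \<eta> t) \<le> kernel \<eta> x y"
      unfolding kernel_eq_integral[OF \<eta>]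
    proof (rule set_integral_mono)
      show "set_integrable lborel time_interval (\<lambda>t. k * indicator ?J t - 8 / R * log_density \<eta> t)"
        using L2(1) iJ by (intro set_integral_diff set_integrable_mult_right) auto
      fix t :: real assume tI: "t \<in> time_interval"
      hence t: "0 < t" "t \<le> 1" using time_interval_less_1 by force+
      have ld: "log_density \<eta> t \<ge> 0" by (rule log_density_nonneg[OF t(1)])
      have "exp (- t) * (indicator ?J t * (exp (- (36 * pi)) / (2 * sqrt t)) - 8 / (R * sqrt t))
          * (sqrt t * log_density \<eta> t) \<le> kernel_integrand \<eta> x y t"
        unfolding kernel_integrand_def using t ld Rb
        by (intro mult_right_mono mult_left_mono heat_lower_near[OF _ x y t]) auto
      moreover have "exp (- t) * (indicator ?J t * (exp (- (36 * pi)) / (2 * sqrt t)) - 8 / (R * sqrt t))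
          * (sqrt t * log_density \<eta> t) =
          exp (- t) * (exp (- (36 * pi)) / 2 * (indicator ?J t * log_density \<eta> t)) - exp (- t) * (8 / R * log_density \<eta> t)"
        using t by (simp add: field_simps)
      moreover have "exp (- t) * (8 / R * log_density \<eta> t) \<le> 1 * (8 / R * log_density \<eta> t)"
        using t ld Rb by (intro mult_right_mono) auto
      moreover have "k * indicator ?J t \<le> exp (- t) * (exp (- (36 * pi)) / 2 * (indicator ?J t * log_density \<eta> t))"
      proof (cases "t \<in> ?J")
        case True
        have l2: "2 < ln (1 / t)" using tI two_le_ln_inverse by simp
        have "1 / t \<le> R\<^sup>2" using True t Rb by (simp add: field_simps)
        hence "ln (1 / t) \<le> ln (R\<^sup>2)" using t Rb by (subst ln_le_cancel_iff) auto
        also have "\<dots> = 2 * ln R" using Rb by (simp add: ln_realpow)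
        finally have "(2 * ln R) powr (- 1 - \<eta>) \<le> ln (1 / t) powr (- 1 - \<eta>)"
          using l2 \<eta> by (intro powr_mono2') auto
        moreover have "R\<^sup>2 / 2 \<le> 1 / t" using True t Rb by (simp add: field_simps)
        ultimately have "R\<^sup>2 / 2 * (2 * ln R) powr (- 1 - \<eta>) \<le> 1 / t * ln (1 / t) powr (- 1 - \<eta>)"
          using t by (intro mult_mono) auto
        also have "ln (1 / t) powr (- 1 - \<eta>) = 1 / ln (1 / t) powr (1 + \<eta>)"
          using powr_minus_divide[of "ln (1 / t)" "1 + \<eta>"] by simp
        finally have ld2: "R\<^sup>2 / 2 * (2 * ln R) powr (- 1 - \<eta>) \<le> log_density \<eta> t"
          by (simp add: log_density_def)
        have "exp (- 1) * (exp (- (36 * pi)) / 2 * (R\<^sup>2 / 2 * (2 * ln R) powr (- 1 - \<eta>)))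
            \<le> exp (- t) * (exp (- (36 * pi)) / 2 * log_density \<eta> t)"
          using t ld2 by (intro mult_mono) auto
        thus ?thesis using True by (simp add: k_def mult_ac)
      qed simp
      ultimately show "k * indicator ?J t - 8 / R * log_density \<eta> t \<le> kernel_integrand \<eta> x y t" by linarith
    qed (rule kernel_as_integral(1)[OF \<eta>])
    also have "(LBINT t:time_interval. k * indicator ?J t - 8 / R * log_density \<eta> t) =
        (LBINT t:time_interval. k * indicator ?J t) - 8 / R * (LBINT t:time_interval. log_density \<eta> t)"
      using L2(1) iJ by (simp add: set_integral_diff(2))
    also have "(LBINT t:time_interval. k * indicator ?J t) = k * (1 / R\<^sup>2)"
    proof -
      have "(\<lambda>t. indicator time_interval t *\<^sub>R (k * indicator ?J t)) = (\<lambda>t. k * indicator ?J t)"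
        using J by (auto simp: indicator_def fun_eq_iff)
      moreover have "measure lborel ?J = 1 / R\<^sup>2" using Rb by (simp add: field_simps divide_right_mono)
      ultimately show ?thesis unfolding set_lebesgue_integral_def by simp
    qed
    also have "k * (1 / R\<^sup>2) = K * ln R powr (- 1 - \<eta>)"
      using Rb lnR by (simp add: k_def K_def powr_mult)
    also have "8 / R * (LBINT t:time_interval. log_density \<eta> t) = D / R"
      using L2(2) by (simp add: D_def exp_minus)
    finally show "K / 2 * ln R powr (- 1 - \<eta>) \<le> kernel \<eta> x y" using R1[of R] R by simp
  qed (use K in simp)
qed

lemma kernel_sums:
  assumes "0 < \<eta>"
  shows "(\<lambda>j. weight \<eta> j * hermite_fun (4 * j) x * hermite_fun (4 * j) y) sums kernel \<eta> x y"
  using kernel_as_integral(2)[OF assms] unfolding kernel_eq_integral[OF assms] .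

lemma kernel_pos:
  assumes "0 < \<eta>" shows "kernel \<eta> x x > 0"
proof -
  have "hermite_fun 0 x > 0" by (simp add: hermite_fun_def)
  hence "0 < weight \<eta> 0 * hermite_fun (4 * 0) x * hermite_fun (4 * 0) x"
    using weight_pos[OF assms] by simp
  thus ?thesis unfolding kernel_def using kernel_sums[OF assms, of x x] weight_pos[OF assms]
    by (intro suminf_pos2[where i = 0]) (auto simp: sums_iff mult.assoc less_imp_le)
qed

theorem normalized_kernel_near:
  assumes \<eta>: "0 < \<eta>"
  shows "\<exists>c>0. \<exists>R0. \<forall>R\<ge>R0. \<forall>x y. \<bar>x - R\<bar> \<le> 1 / R \<longrightarrow> \<bar>y - R\<bar> \<le> 1 / R \<longrightarrow>
    c / ln R \<le> kernel \<eta> x y / sqrt (kernel \<eta> x x * kernel \<eta> y y)"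
proof -
  obtain c R0 where c: "c > 0" and low: "\<And>R x y. R \<ge> R0 \<Longrightarrow> \<bar>x - R\<bar> \<le> 1 / R \<Longrightarrow> \<bar>y - R\<bar> \<le> 1 / R \<Longrightarrow>
    c * ln R powr (- 1 - \<eta>) \<le> kernel \<eta> x y"
    using kernel_lower_near[OF \<eta>] by blast
  obtain X where X: "\<And>x. x \<ge> X \<Longrightarrow> kernel \<eta> x x \<le> 4 / \<eta> * ln x powr (- \<eta>)"
    using kernel_decay[OF \<eta>] by blast
  define c' where "c' = c * \<eta> / 4 * 2 powr (- \<eta>)"
  have c': "c' > 0" using c \<eta> by (simp add: c'_def)
  show ?thesis
  proof (rule exI[of _ c'], intro conjI exI[of _ "max R0 (max (2 * X) 4)"] allI impI)
    fix R x y :: real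
    assume R: "R \<ge> max R0 (max (2 * X) 4)" and x: "\<bar>x - R\<bar> \<le> 1 / R" and y: "\<bar>y - R\<bar> \<le> 1 / R"
    have R4: "R \<ge> 4" using R by simp
    have lnR: "ln R > 0" using R4 by (simp add: ln_gt_zero)
    define B where "B = 4 / \<eta> * (ln R / 2) powr (- \<eta>)"
    have B: "B > 0" using \<eta> lnR by (simp add: B_def)
    have up: "kernel \<eta> z z \<le> B" if z: "\<bar>z - R\<bar> \<le> 1 / R" for z
    proof -
      have "1 / R \<le> R / 2" using R4 mult_mono[of 4 R 4 R] by (simp add: field_simps)
      hence zR: "R / 2 \<le> z" using abs_le_D2[OF z] by linarith
      have "ln R \<le> ln ((R / 2)\<^sup>2)"
        using R4 by (subst ln_le_cancel_iff) (auto simp: power2_eq_square field_simps)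
      hence "ln R / 2 \<le> ln (R / 2)" using R4 by (simp add: ln_realpow)
      also have "\<dots> \<le> ln z" using zR R4 by (subst ln_le_cancel_iff) auto
      finally have "ln z powr (- \<eta>) \<le> (ln R / 2) powr (- \<eta>)"
        using lnR \<eta> by (intro powr_mono2') auto
      hence "4 / \<eta> * ln z powr (- \<eta>) \<le> B" unfolding B_def using \<eta> by (intro mult_left_mono) auto
      thus ?thesis using X[of z] zR R by simp
    qed
    have pos: "kernel \<eta> x x * kernel \<eta> y y > 0" using kernel_pos[OF \<eta>] by simp
    have "kernel \<eta> x x * kernel \<eta> y y \<le> B * B"
      using up[OF x] up[OF y] kernel_pos[OF \<eta>] B by (intro mult_mono) (auto simp: less_imp_le)
    hence sB: "sqrt (kernel \<eta> x x * kernel \<eta> y y) \<le> B"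
      using B real_le_lsqrt by (simp add: real_sqrt_le_iff power2_eq_square real_le_lsqrt)
    have "c' / ln R = c * ln R powr (- 1 - \<eta>) / B"
    proof -
      have "ln R powr (- 1 - \<eta>) = ln R powr (- \<eta>) / ln R"
        using lnR powr_add[of "ln R" "- 1" "- \<eta>"] by (simp add: powr_minus divide_inverse mult.commute)
      moreover have "(ln R / 2) powr (- \<eta>) = ln R powr (- \<eta>) / 2 powr (- \<eta>)"
        by (rule powr_divide)
      ultimately show ?thesis using lnR \<eta> unfolding c'_def B_def by simp
    qed
    also have "\<dots> \<le> kernel \<eta> x y / B"
      using low[of R x y] R x y B by (intro divide_right_mono) auto
    also have "\<dots> \<le> kernel \<eta> x y / sqrt (kernel \<eta> x x * kernel \<eta> y y)"
    proof (rule divide_left_mono[OF sB])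
      have "0 \<le> c * ln R powr (- 1 - \<eta>)" using c by simp
      also have "\<dots> \<le> kernel \<eta> x y" using low[of R x y] R x y by auto
      finally show "0 \<le> kernel \<eta> x y" .
      show "0 < B * sqrt (kernel \<eta> x x * kernel \<eta> y y)" using B pos by simp
    qed
    finally show "c' / ln R \<le> kernel \<eta> x y / sqrt (kernel \<eta> x x * kernel \<eta> y y)" .
  qed (rule c')
qed

section \<open>Uniform boundedness on square-summable sequences\<close>

text \<open>Balls are described through finite sections: this makes convergence of the
  series part of the membership, and makes balls visibly closed under coordinatewise limits.\<close>

definition ell2_ball :: "real \<Rightarrow> (nat \<Rightarrow> real) set" where
  "ell2_ball r = {v. \<forall>J. L2_set v {..<J} \<le> r}"

lemma ell2_ballD: "v \<in> ell2_ball r \<Longrightarrow> L2_set v {..<J} \<le> r"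
  by (simp add: ell2_ball_def)

lemma ell2_ball_add:
  assumes "u \<in> ell2_ball r" "v \<in> ell2_ball s"
  shows "(\<lambda>j. u j + v j) \<in> ell2_ball (r + s)"
  unfolding ell2_ball_def mem_Collect_eq
  using order_trans[OF L2_set_triangle_ineq add_mono[OF ell2_ballD[OF assms(1)] ell2_ballD[OF assms(2)]]]
  by blast

lemma ell2_ball_scale:
  assumes "u \<in> ell2_ball r" shows "(\<lambda>j. c * u j) \<in> ell2_ball (\<bar>c\<bar> * r)"
proof -
  have "L2_set (\<lambda>j. c * u j) {..<J} = \<bar>c\<bar> * L2_set u {..<J}" for J
  proof -
    have "L2_set (\<lambda>j. c * u j) {..<J} = L2_set (\<lambda>j. \<bar>c\<bar> * u j) {..<J}"
      unfolding L2_set_def by (simp add: power_mult_distrib)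
    thus ?thesis by (simp add: L2_set_right_distrib)
  qed
  thus ?thesis using assms unfolding ell2_ball_def by (auto intro: mult_left_mono)
qed

lemma ell2_ball_mono: "u \<in> ell2_ball r \<Longrightarrow> r \<le> s \<Longrightarrow> u \<in> ell2_ball s"
  unfolding ell2_ball_def using order_trans by blast

lemma ell2_ball_radius_nonneg: "u \<in> ell2_ball r \<Longrightarrow> 0 \<le> r"
  using ell2_ballD[of u r 0] by simp

lemma ell2_in_ball:
  assumes "v \<in> ell2" shows "v \<in> ell2_ball (sqrt (\<Sum>n. (v n)\<^sup>2))"
proof -
  have "(\<Sum>n<J. (v n)\<^sup>2) \<le> (\<Sum>n. (v n)\<^sup>2)" for J
    using assms by (intro sum_le_suminf) (auto simp: ell2_def)
  thus ?thesis unfolding ell2_ball_def L2_set_def by simp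
qed

lemma ell2_ball_imp_ell2:
  assumes "v \<in> ell2_ball r" shows "v \<in> ell2"
proof -
  have "(\<Sum>n<J. (v n)\<^sup>2) \<le> r\<^sup>2" for J
    using ell2_ballD[OF assms, of J] ell2_ball_radius_nonneg[OF assms]
    unfolding L2_set_def by (simp add: sqrt_le_D)
  thus ?thesis unfolding ell2_def by (auto intro!: summableI_nonneg_bounded)
qed

lemma ell2_add: "u \<in> ell2 \<Longrightarrow> v \<in> ell2 \<Longrightarrow> (\<lambda>j. u j + v j) \<in> ell2"
  by (rule ell2_ball_imp_ell2[OF ell2_ball_add[OF ell2_in_ball ell2_in_ball]])

lemma ell2_scale: "u \<in> ell2 \<Longrightarrow> (\<lambda>j. c * u j) \<in> ell2"
  by (rule ell2_ball_imp_ell2[OF ell2_ball_scale[OF ell2_in_ball]])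

lemma ell2_cauchy_schwarz:
  assumes "u \<in> ell2_ball r" "v \<in> ell2_ball s"
  shows "summable (\<lambda>j. u j * v j)" "\<bar>\<Sum>j. u j * v j\<bar> \<le> r * s"
proof -
  have le: "(\<Sum>j<J. \<bar>u j * v j\<bar>) \<le> r * s" for J
  proof -
    have "(\<Sum>j<J. \<bar>u j * v j\<bar>) \<le> L2_set u {..<J} * L2_set v {..<J}"
      unfolding abs_mult by (rule L2_set_mult_ineq)
    also have "\<dots> \<le> r * s"
      using assms by (intro mult_mono ell2_ballD L2_set_nonneg ell2_ball_radius_nonneg)
    finally show ?thesis .
  qed
  have s: "summable (\<lambda>j. \<bar>u j * v j\<bar>)" using le by (intro summableI_nonneg_bounded) auto
  thus "summable (\<lambda>j. u j * v j)" by (rule summable_rabs_cancel)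
  have "\<bar>\<Sum>j. u j * v j\<bar> \<le> (\<Sum>j. \<bar>u j * v j\<bar>)" using s by (rule summable_rabs)
  also have "\<dots> \<le> r * s" using s le by (rule suminf_le_const)
  finally show "\<bar>\<Sum>j. u j * v j\<bar> \<le> r * s" .
qed

text \<open>Completeness of \<open>\<ell>\<^sup>2\<close> in the form needed for a category argument.\<close>

lemma ell2_nested_balls:
  fixes b :: "nat \<Rightarrow> nat \<Rightarrow> real" and r :: "nat \<Rightarrow> real"
  assumes r: "r \<longlonglongrightarrow> 0"
    and nested: "\<And>i j. i \<le> j \<Longrightarrow> (\<lambda>l. b j l - b i l) \<in> ell2_ball (r i)"
  obtains w where "\<And>i. (\<lambda>l. w l - b i l) \<in> ell2_ball (r i)"
proof -
  have coord: "\<bar>b j l - b i l\<bar> \<le> r i" if "i \<le> j" for i j l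
  proof -
    have "\<bar>b j l - b i l\<bar> \<le> L2_set (\<lambda>l. \<bar>b j l - b i l\<bar>) {..<Suc l}"
      by (rule member_le_L2_set) auto
    also have "\<dots> = L2_set (\<lambda>l. b j l - b i l) {..<Suc l}" by (simp add: L2_set_def)
    also have "\<dots> \<le> r i" by (rule ell2_ballD[OF nested[OF that]])
    finally show ?thesis .
  qed
  have "Cauchy (\<lambda>j. b j l)" for l
  proof (rule metric_CauchyI)
    fix e :: real assume "e > 0"
    then obtain N where N: "r N < e / 2"
      using order_tendstoD(2)[OF r, of "e / 2"] by (auto simp: eventually_sequentially)
    show "\<exists>M. \<forall>m\<ge>M. \<forall>n\<ge>M. dist (b m l) (b n l) < e"
    proof (intro exI[of _ N] allI impI)
      fix m n assume "N \<le> m" "N \<le> n"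
      thus "dist (b m l) (b n l) < e"
        using coord[of N m l] coord[of N n l] N unfolding dist_real_def by linarith
    qed
  qed
  hence "convergent (\<lambda>j. b j l)" for l by (simp add: Cauchy_convergent_iff)
  then obtain w where w: "\<And>l. (\<lambda>j. b j l) \<longlonglongrightarrow> w l" unfolding convergent_def by metis
  have "(\<lambda>l. w l - b i l) \<in> ell2_ball (r i)" for i
    unfolding ell2_ball_def mem_Collect_eq
  proof
    fix J
    have "(\<lambda>j. L2_set (\<lambda>l. b j l - b i l) {..<J}) \<longlonglongrightarrow> L2_set (\<lambda>l. w l - b i l) {..<J}"
      unfolding L2_set_def by (intro tendsto_intros w)
    thus "L2_set (\<lambda>l. w l - b i l) {..<J} \<le> r i"
      by (rule LIMSEQ_le_const2) (use nested ell2_ballD in blast)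
  qed
  thus ?thesis using that by blast
qed

text \<open>If no uniform bound exists, every ball of radius \<open>r\<close> around \<open>b\<close> contains a smaller one on which some
  seminorm exceeds a prescribed \<open>n\<close>: for \<open>h\<close> in the unit ball with \<open>p\<^sub>k(h)\<close> large, one of the points
  \<open>b \<plusminus> (r/2) h\<close> has large seminorm by the triangle inequality, and continuity of \<open>p\<^sub>k\<close> gives a ball
  around it. The common point of a nested sequence of such balls violates pointwise boundedness.\<close>

theorem uniform_boundedness_ell2:
  fixes p :: "nat \<Rightarrow> (nat \<Rightarrow> real) \<Rightarrow> real"
  assumes sub: "\<And>k u v. u \<in> ell2 \<Longrightarrow> v \<in> ell2 \<Longrightarrow> p k (\<lambda>j. u j + v j) \<le> p k u + p k v"
    and hom: "\<And>k c u. u \<in> ell2 \<Longrightarrow> p k (\<lambda>j. c * u j) = \<bar>c\<bar> * p k u"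
    and cont: "\<And>k. \<exists>D>0. \<forall>r. \<forall>u\<in>ell2_ball r. p k u \<le> D * r"
    and ptw: "\<And>u. u \<in> ell2 \<Longrightarrow> \<exists>B. \<forall>k. p k u \<le> B"
  shows "\<exists>C. \<forall>k r. \<forall>u\<in>ell2_ball r. p k u \<le> C * r"
proof (rule ccontr)
  assume neg: "\<nexists>C. \<forall>k r. \<forall>u\<in>ell2_ball r. p k u \<le> C * r"
  have large: "\<exists>k. \<exists>h\<in>ell2_ball 1. C < p k h" for C
  proof -
    have "\<forall>C. \<exists>k r. \<exists>u\<in>ell2_ball r. C * r < p k u" using neg by (simp add: not_le)
    then obtain k r u where u: "u \<in> ell2_ball r" "p k u > C * r" by blast
    obtain D where "D > 0" "\<forall>r. \<forall>u\<in>ell2_ball r. p k u \<le> D * r" using cont by blast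
    hence "r \<noteq> 0" using u by force
    hence r: "r > 0" using ell2_ball_radius_nonneg[OF u(1)] by simp
    have "(\<lambda>j. (1 / r) * u j) \<in> ell2_ball (\<bar>1 / r\<bar> * r)" by (rule ell2_ball_scale[OF u(1)])
    moreover have "p k (\<lambda>j. (1 / r) * u j) = \<bar>1 / r\<bar> * p k u"
      by (rule hom[OF ell2_ball_imp_ell2[OF u(1)]])
    moreover have "C < \<bar>1 / r\<bar> * p k u" using u(2) r by (simp add: field_simps)
    ultimately show ?thesis using r by (intro exI[of _ k] bexI[of _ "\<lambda>j. (1 / r) * u j"]) auto
  qed
  define P where "P n s \<longleftrightarrow> fst s \<in> ell2 \<and> 0 < snd s \<and> snd s \<le> (1/2) ^ n"
    for n and s :: "(nat \<Rightarrow> real) \<times> real"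
  define Q where "Q n s s' \<longleftrightarrow> (\<forall>w. (\<lambda>j. w j - fst s' j) \<in> ell2_ball (snd s') \<longrightarrow>
      (\<lambda>j. w j - fst s j) \<in> ell2_ball (snd s) \<and> (\<exists>k. real n \<le> p k w))"
    for n and s s' :: "(nat \<Rightarrow> real) \<times> real"
  have "\<exists>f. \<forall>n. P n (f n) \<and> Q n (f n) (f (Suc n))"
  proof (rule dependent_nat_choice)
    have "(\<lambda>_. 0) \<in> ell2" by (simp add: ell2_def)
    thus "\<exists>s. P 0 s" unfolding P_def by (intro exI[of _ "(\<lambda>_. 0, 1)"]) simp
  next
    fix s n assume Ps: "P n s"
    obtain b r where s: "s = (b, r)" by fastforce
    have b: "b \<in> ell2" and r: "0 < r" "r \<le> (1/2) ^ n" using Ps unfolding P_def s by auto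
    define \<delta> where "\<delta> = r / 2"
    have \<delta>: "\<delta> > 0" using r by (simp add: \<delta>_def)
    obtain k h where h: "h \<in> ell2_ball 1" "(real n + 1) / \<delta> < p k h" using large by blast
    have h2: "h \<in> ell2" by (rule ell2_ball_imp_ell2[OF h(1)])
    have big: "real n + 1 < \<delta> * p k h" using h(2) \<delta> by (simp add: field_simps)
    obtain D where D: "D > 0" "\<And>r u. u \<in> ell2_ball r \<Longrightarrow> p k u \<le> D * r" using cont by metis
    have "\<exists>\<sigma>. \<bar>\<sigma>\<bar> = \<delta> \<and> real n + 1 \<le> p k (\<lambda>j. b j + \<sigma> * h j)"
    proof (rule ccontr)
      assume "\<not> ?thesis"
      hence small: "\<And>\<sigma>. \<bar>\<sigma>\<bar> = \<delta> \<Longrightarrow> p k (\<lambda>j. b j + \<sigma> * h j) < real n + 1"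
        by (auto simp: not_le)
      have 1: "p k (\<lambda>j. b j + \<delta> * h j) < real n + 1" "p k (\<lambda>j. b j + (- \<delta>) * h j) < real n + 1"
        by (intro small; use \<delta> in simp)+
      have e: "p k (\<lambda>j. (2 * \<delta>) * h j) = \<bar>2 * \<delta>\<bar> * p k h" by (rule hom[OF h2])
      have eq: "(\<lambda>j. (b j + \<delta> * h j) + (- 1) * (b j + (- \<delta>) * h j)) = (\<lambda>j. (2 * \<delta>) * h j)"
        by (auto simp: algebra_simps)
      have "p k (\<lambda>j. (b j + \<delta> * h j) + (- 1) * (b j + (- \<delta>) * h j)) \<le>
          p k (\<lambda>j. b j + \<delta> * h j) + p k (\<lambda>j. (- 1) * (b j + (- \<delta>) * h j))"
        by (intro sub ell2_add ell2_scale b h2)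
      moreover have "p k (\<lambda>j. (- 1) * (b j + (- \<delta>) * h j)) = \<bar>-1\<bar> * p k (\<lambda>j. b j + (- \<delta>) * h j)"
        by (rule hom) (intro ell2_add ell2_scale b h2)
      ultimately show False using e 1 big \<delta> unfolding eq by simp
    qed
    then obtain \<sigma> where \<sigma>: "\<bar>\<sigma>\<bar> = \<delta>" "real n + 1 \<le> p k (\<lambda>j. b j + \<sigma> * h j)" by blast
    define b' where "b' = (\<lambda>j. b j + \<sigma> * h j)"
    define r' where "r' = min \<delta> (1 / D)"
    have b': "b' \<in> ell2" unfolding b'_def by (intro ell2_add ell2_scale b h2)
    have r': "r' > 0" "r' \<le> \<delta>" "D * r' \<le> 1" using \<delta> D by (auto simp: r'_def min_def field_simps)
    show "\<exists>s'. P (Suc n) s' \<and> Q n s s'"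
    proof (intro exI[of _ "(b', r')"] conjI)
      show "P (Suc n) (b', r')" unfolding P_def using b' r' r by (simp add: \<delta>_def)
      show "Q n s (b', r')" unfolding Q_def s fst_conv snd_conv
      proof (intro allI impI conjI)
        fix w assume w: "(\<lambda>j. w j - b' j) \<in> ell2_ball r'"
        have "(\<lambda>j. (w j - b' j) + \<sigma> * h j) \<in> ell2_ball (r' + \<bar>\<sigma>\<bar> * 1)"
          by (intro ell2_ball_add w ell2_ball_scale h)
        hence "(\<lambda>j. w j - b j) \<in> ell2_ball (r' + \<bar>\<sigma>\<bar> * 1)" by (simp add: b'_def)
        moreover have "r' + \<bar>\<sigma>\<bar> * 1 \<le> r" using \<sigma> r' by (simp add: \<delta>_def)
        ultimately show "(\<lambda>j. w j - b j) \<in> ell2_ball r" by (rule ell2_ball_mono)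
        have wd: "(\<lambda>j. w j - b' j) \<in> ell2" by (rule ell2_ball_imp_ell2[OF w])
        have w2: "w \<in> ell2" using ell2_add[OF wd b'] by simp
        have "b' = (\<lambda>j. w j + (- 1) * (w j - b' j))" by auto
        hence "p k b' \<le> p k w + p k (\<lambda>j. (- 1) * (w j - b' j))"
          using sub[OF w2 ell2_scale[OF wd, of "- 1"], of k] by simp
        also have "p k (\<lambda>j. (- 1) * (w j - b' j)) = p k (\<lambda>j. w j - b' j)"
          using hom[OF wd, of k "- 1"] by simp
        also have "\<dots> \<le> D * r'" by (rule D(2)[OF w])
        finally show "\<exists>k. real n \<le> p k w" using \<sigma>(2) r'(3) unfolding b'_def[symmetric] by (intro exI[of _ k]) linarith
      qed
    qed
  qed
  then obtain f where f: "\<And>n. P n (f n)" "\<And>n. Q n (f n) (f (Suc n))" by blast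
  define b where "b n = fst (f n)" for n
  define r where "r n = snd (f n)" for n
  have r: "0 < r n" "r n \<le> (1/2) ^ n" for n using f(1)[of n] by (auto simp: P_def r_def)
  have step: "(\<lambda>j. w j - b n j) \<in> ell2_ball (r n)" "\<exists>k. real n \<le> p k w"
    if "(\<lambda>j. w j - b (Suc n) j) \<in> ell2_ball (r (Suc n))" for n w
    using f(2)[of n] that unfolding Q_def b_def r_def by blast+
  have nested: "(\<lambda>l. b j l - b i l) \<in> ell2_ball (r i)" if "i \<le> j" for i j
    using that
  proof (induction rule: inc_induct)
    case base
    have "L2_set (\<lambda>l. 0::real) A = 0" for A :: "nat set" by (rule L2_set_0') simp
    thus ?case using r(1)[of j] by (simp add: ell2_ball_def)
  next
    case (step n) thus ?case using \<open>\<And>w n. (\<lambda>j. w j - b (Suc n) j) \<in> ell2_ball (r (Suc n)) \<Longrightarrow>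
       (\<lambda>j. w j - b n j) \<in> ell2_ball (r n)\<close> by blast
  qed
  have "r \<longlonglongrightarrow> 0"
    by (rule tendsto_sandwich[of "\<lambda>_. 0" _ _ "\<lambda>n. (1/2) ^ n"])
       (use r in \<open>auto intro!: always_eventually less_imp_le LIMSEQ_realpow_zero\<close>)
  then obtain w where w: "\<And>i. (\<lambda>l. w l - b i l) \<in> ell2_ball (r i)"
    using ell2_nested_balls[of r b] nested by blast
  have "b 0 \<in> ell2" using f(1)[of 0] by (simp add: P_def b_def)
  hence "w \<in> ell2" using ell2_add[OF ell2_ball_imp_ell2[OF w[of 0]], of "b 0"] by simp
  then obtain B where B: "\<And>k. p k w \<le> B" using ptw by blast
  obtain n where n: "B < real n" using reals_Archimedean2 by blast
  obtain k where "real n \<le> p k w" using step(2)[OF w] by blast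
  thus False using B[of k] n by simp
qed

section \<open>Clusters of nodes\<close>

text \<open>The index increment \<open>d \<le> L\<^bsup>2\<beta>\<^esup>\<close> moves \<open>\<surd>n\<close> by at most \<open>d / \<surd>M\<close>; divided by \<open>L\<^sup>\<beta>\<close> this is at most
  \<open>L\<^sup>\<beta> / \<surd>M\<close>, which is \<open>1 / \<lambda>\<^sub>M\<close>. The growth of the logarithm in the denominator has a smaller effect, by the
  relative amount \<open>\<beta> d / (L M) \<le> d / M\<close>.\<close>

lemma node_cluster:
  fixes \<beta> :: real and M n :: nat
  defines "L \<equiv> ln (exp 1 + real M)"
  assumes \<beta>: "1/2 < \<beta>" "\<beta> \<le> L" and M: "M > 0" and n: "M \<le> n" "real (n - M) \<le> L powr (2 * \<beta>)"
  shows "\<bar>node \<beta> n - node \<beta> M\<bar> \<le> 1 / node \<beta> M"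
proof -
  define d where "d = real (n - M)"
  have d: "real n = real M + d" "d \<ge> 0" "d \<le> L powr (2 * \<beta>)" using n by (auto simp: d_def)
  have L1: "L \<ge> 1"
  proof -
    have "ln (exp 1) \<le> L" unfolding L_def by (subst ln_le_cancel_iff) (auto intro: add_pos_nonneg)
    thus ?thesis by simp
  qed
  define L' where "L' = ln (exp 1 + real n)"
  have e0: "exp 1 + real M > 0" by (simp add: add_pos_nonneg)
  have en: "exp 1 + real n > 0" by (simp add: add_pos_nonneg)
  have LL': "L \<le> L'"
    unfolding L_def L'_def using e0 n by (subst ln_le_cancel_iff) auto
  have rM: "sqrt (real M) > 0" using M by simp
  define Lb where "Lb = L powr \<beta>"
  have Lb: "Lb > 0" using L1 by (simp add: Lb_def)
  have Lb2: "L powr (2 * \<beta>) = Lb * Lb" by (simp add: Lb_def powr_add[symmetric])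
  have R: "node \<beta> M = sqrt (real M) / Lb" by (simp add: node_def L_def Lb_def)
  have invR: "1 / node \<beta> M = Lb / sqrt (real M)" unfolding R by simp
  have up: "node \<beta> n - node \<beta> M \<le> 1 / node \<beta> M"
  proof -
    have "Lb \<le> L' powr \<beta>" unfolding Lb_def using LL' L1 \<beta> by (intro powr_mono2) auto
    hence "node \<beta> n \<le> sqrt (real n) / Lb"
      unfolding node_def L'_def[symmetric] using Lb by (intro divide_left_mono mult_pos_pos) auto
    hence "node \<beta> n - node \<beta> M \<le> (sqrt (real n) - sqrt (real M)) / Lb"
      unfolding R by (simp add: diff_divide_distrib)
    also have "sqrt (real n) - sqrt (real M) \<le> d / sqrt (real M)"
    proof -
      have "(sqrt (real n) - sqrt (real M)) * sqrt (real M) \<le>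
          (sqrt (real n) - sqrt (real M)) * (sqrt (real n) + sqrt (real M))"
        using n by (intro mult_left_mono) auto
      also have "\<dots> = d" using d by (simp add: algebra_simps)
      finally show ?thesis using rM by (simp add: field_simps)
    qed
    also have "d / sqrt (real M) / Lb \<le> (Lb * Lb) / sqrt (real M) / Lb"
      using d rM Lb unfolding Lb2 by (intro divide_right_mono) auto
    also have "\<dots> = 1 / node \<beta> M" unfolding invR using Lb by simp
    finally show ?thesis using Lb by (simp add: divide_right_mono)
  qed
  have down: "node \<beta> M - node \<beta> n \<le> 1 / node \<beta> M"
  proof -
    define q where "q = L' / L"
    have q1: "q \<ge> 1" using LL' L1 by (simp add: q_def)
    have "L' \<le> L + d / real M"
    proof -
      have "L' - L = ln ((exp 1 + real n) / (exp 1 + real M))"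
        unfolding L'_def L_def using e0 en by (subst ln_div) auto
      also have "(exp 1 + real n) / (exp 1 + real M) = 1 + d / (exp 1 + real M)"
        using e0 d by (simp add: field_simps)
      also have "ln (1 + d / (exp 1 + real M)) \<le> d / (exp 1 + real M)"
        using d e0 by (intro ln_add_one_self_le_self) auto
      also have "\<dots> \<le> d / real M" using d M by (intro divide_left_mono) (auto intro!: mult_pos_pos add_pos_nonneg)
      finally show ?thesis by simp
    qed
    hence "q - 1 \<le> d / real M / L" using L1 by (simp add: q_def field_simps)
    also have "\<dots> \<le> d / real M / \<beta>" using d \<beta> by (intro divide_left_mono) auto
    finally have "\<beta> * (q - 1) \<le> \<beta> * (d / real M / \<beta>)" using \<beta> by (intro mult_left_mono) auto
    hence "\<beta> * (q - 1) \<le> d / real M" using \<beta> by simp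
    have "1 - q powr (- \<beta>) \<le> \<beta> * ln q"
    proof -
      have "1 + (- \<beta> * ln q) \<le> exp (- \<beta> * ln q)" by (rule exp_ge_add_one_self)
      also have "\<dots> = q powr (- \<beta>)" using q1 by (simp add: powr_def)
      finally show ?thesis by simp
    qed
    also have "\<dots> \<le> \<beta> * (q - 1)" using q1 \<beta> by (intro mult_left_mono ln_le_minus_one) auto
    also have "\<dots> \<le> d / real M" by fact
    finally have qb: "1 - q powr (- \<beta>) \<le> d / real M" .
    have "L' powr \<beta> = Lb * q powr \<beta>"
      using L1 q1 unfolding Lb_def q_def by (simp add: powr_divide)
    hence "sqrt (real M) / Lb * q powr (- \<beta>) = sqrt (real M) / (L' powr \<beta>)"
      by (simp add: powr_minus divide_inverse)
    also have "\<dots> \<le> node \<beta> n"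
      unfolding node_def L'_def[symmetric] using n by (intro divide_right_mono) auto
    finally have "node \<beta> M - node \<beta> n \<le> node \<beta> M * (1 - q powr (- \<beta>))"
      unfolding R by (simp add: algebra_simps)
    also have "\<dots> \<le> node \<beta> M * (d / real M)"
      unfolding R using qb Lb by (intro mult_left_mono) auto
    also have "\<dots> \<le> node \<beta> M * (Lb * Lb / real M)"
      unfolding R using d Lb unfolding Lb2 by (intro mult_left_mono divide_right_mono) auto
    also have "\<dots> = Lb / sqrt (real M)"
    proof -
      have "real M = sqrt (real M) * sqrt (real M)" by simp
      hence "sqrt (real M) / real M = 1 / sqrt (real M)" using rM
        by (metis divide_divide_eq_left divide_self less_irrefl)
      moreover have "node \<beta> M * (Lb * Lb / real M) = Lb * (sqrt (real M) / real M)"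
        unfolding R using Lb by simp
      ultimately show ?thesis by simp
    qed
    finally show ?thesis unfolding invR .
  qed
  show ?thesis using up down by (simp add: abs_le_iff)
qed

text \<open>With \<open>L = log(e + M)\<close>, a cluster has about \<open>L\<^bsup>2\<beta>\<^esup>\<close> members and entries at least \<open>c / L\<close>.\<close>

lemma gram_clusters:
  assumes \<beta>: "1/2 < \<beta>" and \<eta>: "0 < \<eta>"
  shows "\<exists>F a. finite F \<and> F \<noteq> {} \<and> 0 < a \<and> B \<le> a * real (card F) \<and> (\<forall>m\<in>F. \<forall>n\<in>F. a \<le> gram \<beta> \<eta> m n)"
proof -
  obtain c R0 where c: "c > 0" and near: "\<And>R x y. R \<ge> R0 \<Longrightarrow> \<bar>x - R\<bar> \<le> 1 / R \<Longrightarrow> \<bar>y - R\<bar> \<le> 1 / R \<Longrightarrow>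
    c / ln R \<le> kernel \<eta> x y / sqrt (kernel \<eta> x x * kernel \<eta> y y)"
    using normalized_kernel_near[OF \<eta>] by blast
  have "eventually (\<lambda>M::nat. max R0 2 \<le> node \<beta> M) sequentially"
  proof -
    have "filterlim (\<lambda>M::nat. sqrt (real M) / ln (exp 1 + real M) powr \<beta>) at_top sequentially"
      by real_asymp
    thus ?thesis unfolding node_def filterlim_at_top by blast
  qed
  moreover have "eventually (\<lambda>M::nat. \<beta> \<le> ln (exp 1 + real M)) sequentially" by real_asymp
  moreover have "eventually (\<lambda>M::nat. B \<le> c * ln (exp 1 + real M) powr (2 * \<beta> - 1)) sequentially"
  proof -
    have "filterlim (\<lambda>M::nat. c * ln (exp 1 + real M) powr (2 * \<beta> - 1)) at_top sequentially"
      using c \<beta> by real_asymp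
    thus ?thesis unfolding filterlim_at_top by blast
  qed
  moreover have "eventually (\<lambda>M::nat. M > 0) sequentially" by (rule eventually_gt_at_top)
  ultimately have "eventually (\<lambda>M::nat. max R0 2 \<le> node \<beta> M \<and> \<beta> \<le> ln (exp 1 + real M) \<and>
      B \<le> c * ln (exp 1 + real M) powr (2 * \<beta> - 1) \<and> M > 0) sequentially"
    by eventually_elim auto
  then obtain M :: nat where M: "max R0 2 \<le> node \<beta> M" "\<beta> \<le> ln (exp 1 + real M)"
      "B \<le> c * ln (exp 1 + real M) powr (2 * \<beta> - 1)" "M > 0"
    unfolding eventually_sequentially by blast
  define L where "L = ln (exp 1 + real M)"
  define R where "R = node \<beta> M"
  define P where "P = nat \<lfloor>L powr (2 * \<beta>)\<rfloor>"
  define F where "F = Suc ` {M..M + P}"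
  have L1: "L \<ge> 1"
  proof -
    have "ln (exp 1) \<le> L" unfolding L_def by (subst ln_le_cancel_iff) (auto intro: add_pos_nonneg)
    thus ?thesis by simp
  qed
  have R: "R \<ge> R0" "R \<ge> 2" using M(1) by (auto simp: R_def)
  have lnR: "0 < ln R" "ln R \<le> L"
  proof -
    show "0 < ln R" using R by (simp add: ln_gt_zero)
    have "R \<le> sqrt (real M) / 1"
      unfolding R_def node_def L_def[symmetric] using L1 \<beta>
      by (intro divide_left_mono) (auto intro!: ge_one_powr_ge_zero)
    also have "\<dots> \<le> real M" using M(4) by (simp add: real_le_lsqrt power2_eq_square)
    also have "\<dots> \<le> exp 1 + real M" by simp
    finally show "ln R \<le> L" unfolding L_def using R by (subst ln_le_cancel_iff) auto
  qed
  have P: "real P \<le> L powr (2 * \<beta>)" "L powr (2 * \<beta>) \<le> real P + 1"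
    unfolding P_def by (simp_all add: of_nat_nat)
  have cF: "card F = P + 1" unfolding F_def by (subst card_image) auto
  have node_near: "\<bar>node_star \<beta> m - R\<bar> \<le> 1 / R" if mF: "m \<in> F" for m
  proof -
    obtain n where n: "m = Suc n" "M \<le> n" "n \<le> M + P" using mF unfolding F_def
      by (auto simp del: image_Suc_atLeastAtMost)
    have "real (n - M) \<le> real P" using n by simp
    hence "real (n - M) \<le> L powr (2 * \<beta>)" using P by linarith
    hence "\<bar>node \<beta> n - node \<beta> M\<bar> \<le> 1 / node \<beta> M"
      unfolding L_def using \<beta> M n by (intro node_cluster) auto
    thus ?thesis by (simp add: n node_star_def R_def)
  qed
  show ?thesis
  proof (intro exI[of _ F] exI[of _ "c / L"] conjI ballI)
    show "finite F" "F \<noteq> {}" by (auto simp: F_def)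
    show "0 < c / L" using c L1 by simp
    have "L powr (2 * \<beta> - 1) = L powr (2 * \<beta>) / L" using L1 by (simp add: powr_diff)
    hence "B \<le> c / L * L powr (2 * \<beta>)" using M(3) unfolding L_def[symmetric] by simp
    also have "\<dots> \<le> c / L * real (card F)"
      unfolding cF using P c L1 by (intro mult_left_mono) auto
    finally show "B \<le> c / L * real (card F)" .
    fix m n assume "m \<in> F" "n \<in> F"
    hence "c / ln R \<le> gram \<beta> \<eta> m n" unfolding gram_def by (intro near R node_near)
    moreover have "c / L \<le> c / ln R" using c lnR by (intro divide_left_mono) auto
    ultimately show "c / L \<le> gram \<beta> \<eta> m n" by simp
  qed
qed

text \<open>On the indicator of a block with entries at least \<open>a\<close> and size \<open>N\<close>, the matrix multiplies the
  norm by at least \<open>a N\<close>.\<close>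

lemma gram_unbounded:
  assumes \<beta>: "1/2 < \<beta>" and \<eta>: "0 < \<eta>"
  shows "\<not> bounded_on_ell2 (gram \<beta> \<eta>)"
proof
  assume "bounded_on_ell2 (gram \<beta> \<eta>)"
  then obtain C where C: "\<And>v. v \<in> ell2 \<Longrightarrow> mat_apply (gram \<beta> \<eta>) v \<in> ell2 \<and>
      ell2_norm (mat_apply (gram \<beta> \<eta>) v) \<le> C * ell2_norm v"
    unfolding bounded_on_ell2_def by blast
  obtain F a where F: "finite F" "F \<noteq> {}" "0 < a" "\<bar>C\<bar> + 1 \<le> a * real (card F)"
    "\<And>m n. m \<in> F \<Longrightarrow> n \<in> F \<Longrightarrow> a \<le> gram \<beta> \<eta> m n"
    using gram_clusters[OF \<beta> \<eta>, of "\<bar>C\<bar> + 1"] by blast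
  define v :: "nat \<Rightarrow> real" where "v = indicator F"
  define u where "u = mat_apply (gram \<beta> \<eta>) v"
  have v2: "(\<lambda>n. (v n)\<^sup>2) sums real (card F)"
  proof -
    have "(\<lambda>n. (v n)\<^sup>2) sums (\<Sum>n\<in>F. (v n)\<^sup>2)"
      by (rule sums_finite[OF F(1)]) (simp add: v_def)
    thus ?thesis by (simp add: v_def)
  qed
  have v: "v \<in> ell2" "ell2_norm v = sqrt (real (card F))"
    using v2 by (auto simp: ell2_def ell2_norm_def sums_iff)
  have u: "u \<in> ell2" "ell2_norm u \<le> C * sqrt (real (card F))" using C[OF v(1)] v(2) by (auto simp: u_def)
  have um: "\<bar>C\<bar> + 1 \<le> u m" if "m \<in> F" for m
  proof -
    have "u m = (\<Sum>n\<in>F. gram \<beta> \<eta> m n * v n)"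
      unfolding u_def mat_apply_def by (rule suminf_finite[OF F(1)]) (simp add: v_def)
    also have "\<dots> = (\<Sum>n\<in>F. gram \<beta> \<eta> m n)" by (simp add: v_def)
    also have "\<dots> \<ge> (\<Sum>n\<in>F. a)" using F(5) that by (intro sum_mono) auto
    finally show ?thesis using F(4) by (simp add: mult.commute)
  qed
  have "real (card F) * (\<bar>C\<bar> + 1)\<^sup>2 \<le> (\<Sum>m\<in>F. (u m)\<^sup>2)"
    using sum_mono[of F "\<lambda>_. (\<bar>C\<bar> + 1)\<^sup>2" "\<lambda>m. (u m)\<^sup>2"] um by (simp add: power_mono)
  also have "\<dots> \<le> (\<Sum>m. (u m)\<^sup>2)" using u(1) F(1) by (intro sum_le_suminf) (auto simp: ell2_def)
  finally have "sqrt (real (card F) * (\<bar>C\<bar> + 1)\<^sup>2) \<le> ell2_norm u" unfolding ell2_norm_def by simp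
  hence "(\<bar>C\<bar> + 1) * sqrt (real (card F)) \<le> C * sqrt (real (card F))"
    using u(2) by (simp add: real_sqrt_mult mult.commute)
  moreover have "sqrt (real (card F)) > 0" using F by (simp add: card_gt_0_iff)
  ultimately have "\<bar>C\<bar> + 1 \<le> C" by (simp add: mult_le_cancel_right)
  thus False by simp
qed

section \<open>The sampling operator\<close>

text \<open>The coordinates of the reproducing kernel at \<open>x\<close> in the orthonormal basis \<open>\<surd>a\<^sub>j \<psi>\<^sub>4\<^sub>j\<close> of \<open>\<H>\<^sub>\<eta>\<close>.\<close>

definition kernel_feature :: "real \<Rightarrow> real \<Rightarrow> nat \<Rightarrow> real" where
  "kernel_feature \<eta> x j = sqrt (weight \<eta> j) * hermite_fun (4 * j) x"

definition synthesis :: "real \<Rightarrow> (nat \<Rightarrow> real) \<Rightarrow> real \<Rightarrow> real" where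
  "synthesis \<eta> b x = (\<Sum>j. b j * kernel_feature \<eta> x j)"

lemma kernel_feature_mult:
  assumes "0 < \<eta>"
  shows "(\<lambda>j. kernel_feature \<eta> x j * kernel_feature \<eta> y j) sums kernel \<eta> x y"
proof -
  have "kernel_feature \<eta> x j * kernel_feature \<eta> y j =
      (sqrt (weight \<eta> j) * sqrt (weight \<eta> j)) * hermite_fun (4 * j) x * hermite_fun (4 * j) y" for j
    unfolding kernel_feature_def by simp
  also have "\<dots> j = weight \<eta> j * hermite_fun (4 * j) x * hermite_fun (4 * j) y" for j
    using weight_pos[OF assms, of j] by simp
  finally show ?thesis using kernel_sums[OF assms, of x y] by simp
qed

lemma kernel_feature_ball:
  assumes "0 < \<eta>" shows "kernel_feature \<eta> x \<in> ell2_ball (sqrt (kernel \<eta> x x))"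
proof -
  have s: "(\<lambda>j. (kernel_feature \<eta> x j)\<^sup>2) sums kernel \<eta> x x"
    using kernel_feature_mult[OF assms, of x x] by (simp add: power2_eq_square)
  hence "kernel_feature \<eta> x \<in> ell2" by (auto simp: ell2_def sums_iff)
  from ell2_in_ball[OF this] show ?thesis using s by (simp add: sums_iff)
qed

lemma kernel_feature_ball_uniform:
  assumes "0 < \<eta>" shows "kernel_feature \<eta> x \<in> ell2_ball (sqrt (3 * 2 powr (- \<eta>) / \<eta>))"
  using kernel_feature_ball[OF assms] by (rule ell2_ball_mono) (use kernel_le[OF assms] in simp)

lemma ell2_shift: "b \<in> ell2 \<Longrightarrow> (\<lambda>j. b (j + N)) \<in> ell2"
  unfolding ell2_def by (auto intro: summable_ignore_initial_segment)

lemma ell2_ball_shift: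
  assumes "b \<in> ell2_ball r" shows "(\<lambda>j. b (j + N)) \<in> ell2_ball r"
  unfolding ell2_ball_def mem_Collect_eq
proof
  fix J
  have "(\<Sum>j<J. (b (j + N))\<^sup>2) = (\<Sum>j\<in>{N..<J + N}. (b j)\<^sup>2)"
    using sum.shift_bounds_nat_ivl[of "\<lambda>j. (b j)\<^sup>2" 0 N J] by (simp add: lessThan_atLeast0)
  also have "\<dots> \<le> (\<Sum>j<J + N. (b j)\<^sup>2)" by (intro sum_mono2) auto
  finally have "L2_set (\<lambda>j. b (j + N)) {..<J} \<le> L2_set b {..<J + N}"
    unfolding L2_set_def by simp
  thus "L2_set (\<lambda>j. b (j + N)) {..<J} \<le> r" using ell2_ballD[OF assms, of "J + N"] by simp
qed

lemma ell2_tail_tendsto_0: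
  assumes "b \<in> ell2" shows "(\<lambda>N. \<Sum>j. (b (j + N))\<^sup>2) \<longlonglongrightarrow> 0"
proof -
  have s: "summable (\<lambda>j. (b j)\<^sup>2)" using assms by (simp add: ell2_def)
  have "(\<lambda>N. (\<Sum>j. (b j)\<^sup>2) - (\<Sum>j<N. (b j)\<^sup>2)) \<longlonglongrightarrow> (\<Sum>j. (b j)\<^sup>2) - (\<Sum>j. (b j)\<^sup>2)"
    by (intro tendsto_diff tendsto_const summable_LIMSEQ s)
  thus ?thesis using suminf_minus_initial_segment[OF s] by simp
qed

lemma synthesis_summable:
  assumes "0 < \<eta>" "b \<in> ell2" shows "summable (\<lambda>j. b j * kernel_feature \<eta> x j)"
  using ell2_cauchy_schwarz(1)[OF ell2_in_ball[OF assms(2)] kernel_feature_ball[OF assms(1)]] .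

text \<open>Cauchy-Schwarz for the tail of the series. The bound does not depend on \<open>x\<close> since the kernel is
  bounded on the diagonal, so the series converges uniformly on the real line.\<close>

lemma synthesis_tail:
  assumes "0 < \<eta>" "b \<in> ell2"
  shows "\<bar>synthesis \<eta> b x - (\<Sum>j<N. b j * kernel_feature \<eta> x j)\<bar>
      \<le> sqrt (\<Sum>j. (b (j + N))\<^sup>2) * sqrt (3 * 2 powr (- \<eta>) / \<eta>)"
proof -
  have "synthesis \<eta> b x - (\<Sum>j<N. b j * kernel_feature \<eta> x j) = (\<Sum>j. b (j + N) * kernel_feature \<eta> x (j + N))"
    unfolding synthesis_def using suminf_minus_initial_segment[OF synthesis_summable[OF assms, of x], of N] by simp
  thus ?thesis
    using ell2_cauchy_schwarz(2)[OF ell2_in_ball[OF ell2_shift[OF assms(2), of N]]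
      ell2_ball_shift[OF kernel_feature_ball_uniform[OF assms(1), of x], of N]] by simp
qed

lemma synthesis_continuous:
  assumes "0 < \<eta>" "b \<in> ell2" shows "continuous_on UNIV (synthesis \<eta> b)"
proof (rule uniform_limit_theorem[where F = sequentially])
  show "\<forall>\<^sub>F N in sequentially. continuous_on UNIV (\<lambda>x. \<Sum>j<N. b j * kernel_feature \<eta> x j)"
    unfolding kernel_feature_def by (intro always_eventually allI continuous_intros)
  have "(\<lambda>N. sqrt (\<Sum>j. (b (j + N))\<^sup>2) * sqrt (3 * 2 powr (- \<eta>) / \<eta>)) \<longlonglongrightarrow> sqrt 0 * sqrt (3 * 2 powr (- \<eta>) / \<eta>)"
    by (intro tendsto_intros ell2_tail_tendsto_0 assms)
  hence z: "(\<lambda>N. sqrt (\<Sum>j. (b (j + N))\<^sup>2) * sqrt (3 * 2 powr (- \<eta>) / \<eta>)) \<longlonglongrightarrow> 0" by simp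
  show "uniform_limit UNIV (\<lambda>N x. \<Sum>j<N. b j * kernel_feature \<eta> x j) (synthesis \<eta> b) sequentially"
    unfolding uniform_limit_iff
  proof (intro allI impI)
    fix e :: real assume "e > 0"
    from order_tendstoD(2)[OF z this]
    show "\<forall>\<^sub>F N in sequentially. \<forall>x\<in>UNIV. dist (\<Sum>j<N. b j * kernel_feature \<eta> x j) (synthesis \<eta> b x) < e"
    proof eventually_elim
      case (elim N)
      show ?case
      proof
        fix x show "dist (\<Sum>j<N. b j * kernel_feature \<eta> x j) (synthesis \<eta> b x) < e"
          using synthesis_tail[OF assms, of x N] elim by (simp add: dist_real_def abs_minus_commute)
      qed
    qed
  qed
qed simp

text \<open>Continuity follows from uniform convergence. For the \<open>L\<^sup>2\<close>-convergence, orthonormality computes the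
  norms of the differences of partial sums, and Fatou's lemma passes to the limit.\<close>

lemma synthesis_in_hermite_space:
  assumes \<eta>: "0 < \<eta>" and b: "b \<in> ell2" shows "synthesis \<eta> b \<in> hermite_space \<eta>"
proof -
  define c where "c j = b j * sqrt (weight \<eta> j)" for j
  define A where "A = 2 powr (- \<eta>) / \<eta>"
  have A: "A \<ge> 0" "\<And>j. weight \<eta> j \<le> A" using \<eta> weight_integrable(2)[OF \<eta>] by (simp_all add: A_def)
  have ck: "b j * kernel_feature \<eta> x j = c j * hermite_fun (4 * j) x" for j x
    by (simp add: c_def kernel_feature_def)
  have c2: "(c j)\<^sup>2 = weight \<eta> j * (b j)\<^sup>2" for j
    using weight_pos[OF \<eta>, of j] by (simp add: c_def power_mult_distrib)
  have sb: "summable (\<lambda>j. (b j)\<^sup>2)" using b by (simp add: ell2_def)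
  have sum: "summable (\<lambda>j. (c j)\<^sup>2 / weight \<eta> j)"
  proof -
    have "(c j)\<^sup>2 / weight \<eta> j = (b j)\<^sup>2" for j using weight_pos[OF \<eta>, of j] by (simp add: c2)
    thus ?thesis using sb by simp
  qed
  define g where "g = synthesis \<eta> b"
  define S where "S N x = (\<Sum>j<N. c j * hermite_fun (4 * j) x)" for N x
  have [measurable]: "S N \<in> borel_measurable borel" for N unfolding S_def[abs_def] by measurable
  have Sg: "(\<lambda>N. S N x) \<longlonglongrightarrow> g x" for x
    unfolding S_def g_def synthesis_def ck[symmetric] by (rule summable_LIMSEQ[OF synthesis_summable[OF \<eta> b]])
  have bound: "(\<integral>\<^sup>+ x. ennreal ((g x - S N x)\<^sup>2) \<partial>lborel) \<le> ennreal (A * (\<Sum>j. (b (j + N))\<^sup>2))" for N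
  proof -
    have lim: "liminf (\<lambda>M. ennreal ((S (M + N) x - S N x)\<^sup>2)) = ennreal ((g x - S N x)\<^sup>2)" for x
      by (intro lim_imp_Liminf tendsto_ennrealI tendsto_intros LIMSEQ_ignore_initial_segment Sg) simp
    have "(\<integral>\<^sup>+ x. ennreal ((g x - S N x)\<^sup>2) \<partial>lborel) =
        (\<integral>\<^sup>+ x. liminf (\<lambda>M. ennreal ((S (M + N) x - S N x)\<^sup>2)) \<partial>lborel)"
      unfolding lim ..
    also have "\<dots> \<le> liminf (\<lambda>M. \<integral>\<^sup>+ x. ennreal ((S (M + N) x - S N x)\<^sup>2) \<partial>lborel)"
      by (rule nn_integral_liminf) measurable
    also have "\<dots> \<le> ennreal (A * (\<Sum>j. (b (j + N))\<^sup>2))"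
    proof (intro Liminf_le always_eventually allI)
      fix M
      have "S (M + N) x - S N x = (\<Sum>j\<in>{N..<M + N}. c j * hermite_fun (4 * j) x)" for x
        unfolding S_def lessThan_atLeast0
        using sum.atLeastLessThan_concat[of 0 N "M + N" "\<lambda>j. c j * hermite_fun (4 * j) x"] by simp
      hence "(\<integral>\<^sup>+ x. ennreal ((S (M + N) x - S N x)\<^sup>2) \<partial>lborel) =
          ennreal (LBINT x. (\<Sum>j\<in>{N..<M + N}. c j * hermite_fun (4 * j) x)\<^sup>2)"
        using integral_hermite_sum_square(1)[of "{N..<M + N}" c]
        by (simp add: nn_integral_eq_integral)
      also have "\<dots> = ennreal (\<Sum>j\<in>{N..<M + N}. (c j)\<^sup>2)"
        by (simp add: integral_hermite_sum_square(2))
      also have "(\<Sum>j\<in>{N..<M + N}. (c j)\<^sup>2) = (\<Sum>j<M. (c (j + N))\<^sup>2)"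
        using sum.shift_bounds_nat_ivl[of "\<lambda>j. (c j)\<^sup>2" 0 N M] by (simp add: lessThan_atLeast0)
      also have "ennreal \<dots> \<le> ennreal (A * (\<Sum>j. (b (j + N))\<^sup>2))"
      proof (rule ennreal_leI)
        have "(\<Sum>j<M. (c (j + N))\<^sup>2) \<le> (\<Sum>j<M. A * (b (j + N))\<^sup>2)"
          unfolding c2 by (intro sum_mono mult_right_mono A) auto
        also have "\<dots> = A * (\<Sum>j<M. (b (j + N))\<^sup>2)" by (simp add: sum_distrib_left)
        also have "\<dots> \<le> A * (\<Sum>j. (b (j + N))\<^sup>2)"
          using sb by (intro mult_left_mono A sum_le_suminf summable_ignore_initial_segment) auto
        finally show "(\<Sum>j<M. (c (j + N))\<^sup>2) \<le> A * (\<Sum>j. (b (j + N))\<^sup>2)" .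
      qed
      finally show "(\<integral>\<^sup>+ x. ennreal ((S (M + N) x - S N x)\<^sup>2) \<partial>lborel) \<le> ennreal (A * (\<Sum>j. (b (j + N))\<^sup>2))" .
    qed simp
    finally show ?thesis .
  qed
  have "(\<lambda>N. ennreal (A * (\<Sum>j. (b (j + N))\<^sup>2))) \<longlonglongrightarrow> ennreal (A * 0)"
    by (intro tendsto_ennrealI tendsto_mult_left ell2_tail_tendsto_0 b)
  hence z: "(\<lambda>N. ennreal (A * (\<Sum>j. (b (j + N))\<^sup>2))) \<longlonglongrightarrow> 0" by simp
  have "(\<lambda>N. \<integral>\<^sup>+ x. ennreal ((g x - S N x)\<^sup>2) \<partial>lborel) \<longlonglongrightarrow> 0"
    by (rule tendsto_sandwich[OF _ _ tendsto_const z]) (use bound in auto)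
  thus ?thesis
    unfolding hermite_space_def S_def using sum synthesis_continuous[OF \<eta> b] by (auto simp: g_def)
qed

text \<open>If all samples were square-summable, uniform boundedness, applied to the norms of the first \<open>k\<close>
  samples, would give a bound \<open>C\<close> for the operator. For the sum \<open>b\<close> of the normalized kernels over a
  block \<open>F\<close>, with \<open>S = \<parallel>b\<parallel>\<^sup>2\<close> the sum of the entries of the block, the samples on \<open>F\<close>
  are row sums of the block. Cauchy-Schwarz then yields \<open>S \<le> \<surd>|F| C \<surd>S\<close>, that is \<open>S \<le> C\<^sup>2 |F|\<close>,
  whereas \<open>S \<ge> a |F|\<^sup>2\<close> with \<open>a |F|\<close> unbounded.\<close>

lemma sampling_not_into_ell2:
  assumes \<beta>: "1/2 < \<beta>" and \<eta>: "0 < \<eta>"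
  shows "\<exists>g\<in>hermite_space \<eta>. sampling \<beta> \<eta> g \<notin> ell2"
proof (rule ccontr)
  assume "\<not> ?thesis"
  hence into: "sampling \<beta> \<eta> (synthesis \<eta> b) \<in> ell2" if "b \<in> ell2" for b
    using synthesis_in_hermite_space[OF \<eta> that] by blast
  define \<phi> where "\<phi> n j = kernel_feature \<eta> (node_star \<beta> n) j / sqrt (kernel \<eta> (node_star \<beta> n) (node_star \<beta> n))" for n j
  define s where "s b n = (\<Sum>j. b j * \<phi> n j)" for b n
  have \<phi>_ball: "\<phi> n \<in> ell2_ball 1" for n
  proof -
    let ?k = "kernel \<eta> (node_star \<beta> n) (node_star \<beta> n)"
    have k: "sqrt ?k > 0" using kernel_pos[OF \<eta>] by simp
    have "(\<lambda>j. (1 / sqrt ?k) * kernel_feature \<eta> (node_star \<beta> n) j) \<in> ell2_ball (\<bar>1 / sqrt ?k\<bar> * sqrt ?k)"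
      by (rule ell2_ball_scale[OF kernel_feature_ball[OF \<eta>]])
    thus ?thesis using k unfolding \<phi>_def[abs_def] by simp
  qed
  have s_sum: "summable (\<lambda>j. b j * \<phi> n j)" if "b \<in> ell2" for b n
    using ell2_cauchy_schwarz(1)[OF ell2_in_ball[OF that] \<phi>_ball] .
  have sampling_s: "sampling \<beta> \<eta> (synthesis \<eta> b) = s b" if "b \<in> ell2" for b
  proof
    fix n show "sampling \<beta> \<eta> (synthesis \<eta> b) n = s b n"
      unfolding sampling_def synthesis_def s_def \<phi>_def
      using suminf_divide[OF synthesis_summable[OF \<eta> that]] by simp
  qed
  define p where "p k b = L2_set (s b) {..<k}" for k b
  have s_add: "s (\<lambda>j. u j + v j) n = s u n + s v n" if "u \<in> ell2" "v \<in> ell2" for u v n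
    unfolding s_def using suminf_add[OF s_sum[OF that(1)] s_sum[OF that(2)]] by (simp add: distrib_right)
  have s_scale: "s (\<lambda>j. c * u j) n = c * s u n" if "u \<in> ell2" for c u n
    unfolding s_def using suminf_mult[OF s_sum[OF that], of c] by (simp add: mult.assoc)
  have "\<exists>C. \<forall>k r. \<forall>u\<in>ell2_ball r. p k u \<le> C * r"
  proof (rule uniform_boundedness_ell2)
    fix k and u v :: "nat \<Rightarrow> real" assume uv: "u \<in> ell2" "v \<in> ell2"
    show "p k (\<lambda>j. u j + v j) \<le> p k u + p k v"
      unfolding p_def s_add[OF uv, abs_def] by (rule L2_set_triangle_ineq)
  next
    fix k and u :: "nat \<Rightarrow> real" and c assume u: "u \<in> ell2"
    show "p k (\<lambda>j. c * u j) = \<bar>c\<bar> * p k u"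
      unfolding p_def L2_set_def s_scale[OF u] power_mult_distrib sum_distrib_left[symmetric]
      by (simp add: real_sqrt_mult)
  next
    fix k
    show "\<exists>D>0. \<forall>r. \<forall>u\<in>ell2_ball r. p k u \<le> D * r"
    proof (intro exI[of _ "real k + 1"] conjI allI ballI)
      fix r u assume u: "u \<in> ell2_ball r"
      have r: "r \<ge> 0" by (rule ell2_ball_radius_nonneg[OF u])
      have "p k u \<le> (\<Sum>n<k. \<bar>s u n\<bar>)" unfolding p_def by (rule L2_set_le_sum_abs)
      also have "\<dots> \<le> (\<Sum>n<k. r)"
        using ell2_cauchy_schwarz(2)[OF u \<phi>_ball] by (intro sum_mono) (simp add: s_def)
      also have "\<dots> \<le> (real k + 1) * r" using r by (simp add: distrib_right)
      finally show "p k u \<le> (real k + 1) * r" .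
    qed simp
  next
    fix u :: "nat \<Rightarrow> real" assume "u \<in> ell2"
    hence "s u \<in> ell2" using into sampling_s by metis
    from ell2_ballD[OF ell2_in_ball[OF this]] show "\<exists>B. \<forall>k. p k u \<le> B" unfolding p_def by blast
  qed
  then obtain C where C: "\<And>k r u. u \<in> ell2_ball r \<Longrightarrow> p k u \<le> C * r" by blast
  obtain F a where F: "finite F" "F \<noteq> {}" "0 < a" "C\<^sup>2 + 1 \<le> a * real (card F)"
    "\<And>m n. m \<in> F \<Longrightarrow> n \<in> F \<Longrightarrow> a \<le> gram \<beta> \<eta> m n"
    using gram_clusters[OF \<beta> \<eta>, of "C\<^sup>2 + 1"] by blast
  have gram: "(\<lambda>j. \<phi> m j * \<phi> n j) sums gram \<beta> \<eta> m n" for m n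
    using sums_divide[OF kernel_feature_mult[OF \<eta>, of "node_star \<beta> m" "node_star \<beta> n"],
        of "sqrt (kernel \<eta> (node_star \<beta> m) (node_star \<beta> m) * kernel \<eta> (node_star \<beta> n) (node_star \<beta> n))"]
    unfolding \<phi>_def gram_def by (simp add: real_sqrt_mult)
  define b where "b j = (\<Sum>n\<in>F. \<phi> n j)" for j
  define S where "S = (\<Sum>m\<in>F. \<Sum>n\<in>F. gram \<beta> \<eta> m n)"
  have cF: "real (card F) > 0" using F by (simp add: card_gt_0_iff)
  have "(\<lambda>j. \<Sum>m\<in>F. \<Sum>n\<in>F. \<phi> m j * \<phi> n j) sums S" unfolding S_def by (intro sums_sum gram)
  hence bS: "(\<lambda>j. (b j)\<^sup>2) sums S" by (simp add: b_def power2_eq_square sum_product)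
  have b_ell2: "b \<in> ell2" using bS by (auto simp: ell2_def sums_iff)
  have b_ball: "b \<in> ell2_ball (sqrt S)" using ell2_in_ball[OF b_ell2] bS by (simp add: sums_iff)
  have sb: "s b m = (\<Sum>n\<in>F. gram \<beta> \<eta> n m)" for m
  proof -
    have "(\<lambda>j. \<Sum>n\<in>F. \<phi> n j * \<phi> m j) sums (\<Sum>n\<in>F. gram \<beta> \<eta> n m)" by (intro sums_sum gram)
    thus ?thesis unfolding s_def b_def by (simp add: sum_distrib_right sums_iff)
  qed
  have lowS: "(C\<^sup>2 + 1) * real (card F) \<le> S"
  proof -
    have "(\<Sum>m\<in>F. \<Sum>n\<in>F. a) \<le> S" unfolding S_def using F(5) by (intro sum_mono) auto
    moreover have "(C\<^sup>2 + 1) * real (card F) \<le> a * real (card F) * real (card F)"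
      using F(4) by (intro mult_right_mono) auto
    ultimately show ?thesis by (simp add: mult_ac)
  qed
  hence S0: "S > 0" using cF by (smt (verit) mult_pos_pos zero_le_power2)
  obtain k where k: "F \<subseteq> {..<k}" using finite_nat_bounded[OF F(1)] by blast
  have "S = (\<Sum>m\<in>F. s b m)" unfolding S_def sb by (rule sum.swap)
  also have "\<dots> \<le> (\<Sum>m\<in>F. \<bar>1\<bar> * \<bar>s b m\<bar>)" by (intro sum_mono) simp
  also have "\<dots> \<le> L2_set (\<lambda>_. 1) F * L2_set (s b) F" by (rule L2_set_mult_ineq)
  also have "L2_set (\<lambda>_. 1) F = sqrt (real (card F))" by (simp add: L2_set_constant)
  also have "L2_set (s b) F \<le> p k b"
    unfolding p_def L2_set_def using k by (simp add: sum_mono2)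
  also have "p k b \<le> C * sqrt S" by (rule C[OF b_ball])
  finally have "S \<le> sqrt (real (card F)) * (C * sqrt S)" by (simp add: mult_left_mono)
  hence "S\<^sup>2 \<le> (sqrt (real (card F)) * (C * sqrt S))\<^sup>2" using S0 by (intro power_mono) auto
  also have "\<dots> = real (card F) * C\<^sup>2 * S" using S0 by (simp add: power_mult_distrib)
  finally have "S \<le> real (card F) * C\<^sup>2" using S0 by (simp add: power2_eq_square)
  with lowS show False using cF by (simp add: algebra_simps)
qed

theorem mainTheorem4:
  "\<exists>\<eta>0::real. 0 < \<eta>0 \<and> \<eta>0 < 1 \<and>
     (\<forall>\<beta> \<eta>::real. 1/2 < \<beta> \<longrightarrow> 0 < \<eta> \<longrightarrow> \<eta> \<le> \<eta>0 \<longrightarrow>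
        \<not> bounded_on_ell2 (gram \<beta> \<eta>) \<and>
        \<not> (sampling \<beta> \<eta> ` hermite_space \<eta> = ell2))"
proof (intro exI[of _ "1/2"] conjI allI impI)
  fix \<beta> \<eta> :: real assume \<beta>: "1/2 < \<beta>" and \<eta>: "0 < \<eta>"
  show "\<not> bounded_on_ell2 (gram \<beta> \<eta>)" by (rule gram_unbounded[OF \<beta> \<eta>])
  show "\<not> (sampling \<beta> \<eta> ` hermite_space \<eta> = ell2)"
    using sampling_not_into_ell2[OF \<beta> \<eta>] by blast
qed simp_all

end
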